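(* Let $(B(t))_{t\in\mathbb{Z}}$ be a centered complex-valued wide-sense stationary sequence with spectral measure $\mu$ on $\mathbb{T}=[-\pi,\pi)$ and spectral representation $B(t)=\int_{\mathbb{T}}e^{itu}\,\mathcal{W}(du)$. Assume that $\mu(du)=f(u)\,du$ with $\int_{\mathbb{T}}|\ln f(u)|\,du<\infty$. Let $\ell$ be an energy function (for instance, a polynomial with complex coefficients). Let $f=|\gamma_f|^2$ on $\mathbb{T}$ with $\gamma_f$ an outer function (in the sense of the context), and let $|\ell(e^{iu})|^2+1=|\lambda_\ell(u)|^2$, $u\in\mathbb{T}$, with $\lambda_\ell$ satisfying conditions (i) and (ii) of the context. Let $Q_{>0}$ be the orthogonal projection of $\gamma_f/\overline{\lambda_\ell}$ onto $L^2_{>0}$ in the Hilbert space $L^2(\mathbb{T},\Lambda)$. Then the optimal adaptive approximation is given by $X(t)=\int_{\mathbb{T}}\widehat g_*(u)e^{itu}\,\mathcal{W}(du)$, $t\in\mathbb{Z}$, with $$\widehat g_*(u)=\frac{1}{|\lambda_\ell(u)|^2}-\frac{Q_{>0}(u)}{\lambda_\ell(u)\gamma_f(u)},$$ that is, $\widehat g_*\in\widehat G_{\le 0}$ and $\widehat g_*$ minimizes $$\int_{\mathbb{T}}\left[|\widehat g(u)-1|^2+|\widehat g(u)|^2|\ell(e^{iu})|^2\right]\mu(du)$$ over $\widehat g\in\widehat G_{\le 0}$. The (additional adaptivity) error of the adaptive approximation is given by $$\mathrm{ERR}_{\mathrm A}^+=\|Q_{>0}\|_2^2 .$$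
   Context: Setting. $\Lambda$ denotes Lebesgue measure (unnormalized, $du$) on $\mathbb{T}=[-\pi,\pi)$ and $\|\cdot\|_2$ is the norm of $L^2(\mathbb{T},\Lambda)$. For a subset $A$ of a Hilbert space $H$, $\overline{\mathrm{span}}\{A\,|\,H\}$ is the closed linear span of $A$ in $H$. A centered sequence $B$ with $\mathbb{E}|B(t)|^2<\infty$ is wide-sense stationary if $\mathrm{Cov}(B(t_1),B(t_2))=K_B(t_1-t_2)$ depends only on $t_1-t_2$; its spectral measure is the finite measure $\mu$ on $\mathbb{T}$ with $K_B(t)=\int_{\mathbb{T}}e^{itu}\mu(du)$, and $\mathcal{W}$ is the complex centered random measure on $\mathbb{T}$ with uncorrelated values, $\mathbb{E}|\mathcal{W}(A)|^2=\mu(A)$, such that $B(t)=\int_{\mathbb{T}}e^{itu}\mathcal{W}(du)$. Energy. An energy function $\ell$ is a complex-valued measurable function on the unit circle, typically the restriction of a polynomial $\ell(z)=\sum_{m=0}^M\ell_m z^m$. In the polynomial case the instant energy of a sequence $X$ is $\mathcal{E}[X](t)=\left|\sum_{m=0}^M\ell_m X(t+m)\right|^2$, and for $X(t)=\int_{\mathbb{T}}\widehat g(u)e^{itu}\mathcal{W}(du)$ the quantity $\mathbb{E}|X(0)-B(0)|^2+\mathbb{E}\,\mathcal{E}[X](0)$ equals $\int_{\mathbb{T}}[|\widehat g(u)-1|^2+|\widehat g(u)|^2|\ell(e^{iu})|^2]\mu(du)$. Adaptive problem. Let $\widehat G_{\le 0}:=\overline{\mathrm{span}}\{e^{i\tau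 u},\ \tau\le 0,\ \tau\in\mathbb{Z}\,|\,L^2(\mathbb{T},\mu)\}$. The adaptive approximation problem is to minimize the last integral over $\widehat g\in\widehat G_{\le 0}$ (equivalently, $X(t)$ lies in the closed linear span of $\{B(\tau):\tau\le t\}$ in $L^2(\Omega,\mathbb{P})$ for every $t$). The additional adaptivity error is $$\mathrm{ERR}_{\mathrm A}^+:=\min_{\widehat g\in\widehat G_{\le 0}}\int_{\mathbb{T}}\left|\widehat g(u)-\frac{1}{|\ell(e^{iu})|^2+1}\right|^2\left(|\ell(e^{iu})|^2+1\right)\mu(du).$$ It is the difference between the minimum of $\int_{\mathbb{T}}[|\widehat g-1|^2+|\widehat g|^2|\ell(e^{iu})|^2]\,d\mu$ over $\widehat g\in\widehat G_{\le 0}$ and its minimum over all $\widehat g\in L^2(\mathbb{T},\mu)$, the latter being $\int_{\mathbb{T}}\frac{|\ell(e^{iu})|^2}{|\ell(e^{iu})|^2+1}\mu(du)$. Spaces. $L^2_{\le 0}:=\overline{\mathrm{span}}\{e^{i\tau u},\tau\le 0,\tau\in\mathbb{Z}\,|\,L^2(\mathbb{T},\Lambda)\}$ and $L^2_{>0}:=\overline{\mathrm{span}}\{e^{i\tau u},\tau>0,\tau\in\mathbb{Z}\,|\,L^2(\mathbb{T},\Lambda)\}$. Outer functions. Here a function $\gamma\in L^2(\mathbb{T},\Lambda)$ is called outer (it is the complex conjugate of an outer function in the usual sense) if and only if $\overline{\mathrm{span}}\{\gamma e^{i\tau u},\tau\le 0,\tau\in\mathbb{Z}\,|\,L^2(\mathbb{T},\Lambda)\}=L^2_{\le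 0}$. Conditions on $\lambda_\ell$. (i) $\frac{1}{\lambda_\ell(u)}=\sum_{\tau=0}^\infty\nu_\ell(\tau)e^{-i\tau u}$, $u\in\mathbb{T}$, for some complex coefficients with $\sum_{\tau\ge 0}|\nu_\ell(\tau)|<\infty$ (i.e. a finite complex measure on $\{0,1,2,\dots\}$). (ii) If $\widehat g\in\widehat G_{\le 0}$ and $\lambda_\ell\widehat g\in L^2(\mathbb{T},\mu)$, then $\lambda_\ell\widehat g\in\widehat G_{\le 0}$. *)

theory Defs
  imports "HOL-Probability.Probability"
begin

section \<open>Square-integrable functions and closed linear spans\<close>

text \<open>
  Elements of a space $L^2$ are represented by measurable functions, and every set of functions
  defined in this section is closed under almost everywhere equality. Squared norms take values in
  the extended nonnegative reals, so that they make sense for functions that are not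
  square-integrable.
\<close>

definition L2_normsq :: "'a measure \<Rightarrow> ('a \<Rightarrow> complex) \<Rightarrow> ennreal" where
  "L2_normsq M g = (\<integral>\<^sup>+ x. ennreal ((norm (g x))\<^sup>2) \<partial>M)"

definition L2 :: "'a measure \<Rightarrow> ('a \<Rightarrow> complex) set" where
  "L2 M = {g \<in> borel_measurable M. L2_normsq M g < \<infinity>}"

definition complex_lin_span :: "('a \<Rightarrow> complex) set \<Rightarrow> ('a \<Rightarrow> complex) set" where
  "complex_lin_span A = {(\<lambda>x. \<Sum>h\<in>F. c h * h x) | F c. finite F \<and> F \<subseteq> A}"

definition L2_closed_span :: "'a measure \<Rightarrow> ('a \<Rightarrow> complex) set \<Rightarrow> ('a \<Rightarrow> complex) set" where
  "L2_closed_span M A =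
     {g \<in> L2 M. \<forall>e>0. \<exists>h\<in>complex_lin_span A. L2_normsq M (\<lambda>x. g x - h x) < e}"

definition is_L2_projection ::
    "'a measure \<Rightarrow> ('a \<Rightarrow> complex) set \<Rightarrow> ('a \<Rightarrow> complex) \<Rightarrow> ('a \<Rightarrow> complex) \<Rightarrow> bool" where
  "is_L2_projection M V h Q \<longleftrightarrow>
     h \<in> L2 M \<and> Q \<in> V \<and> (\<forall>v\<in>V. (LINT x|M. (h x - Q x) * cnj (v x)) = 0)"


section \<open>The torus, spaces of one-sided spectrum, outer functions\<close>

abbreviation torus :: "real set" where
  "torus \<equiv> {-pi..<pi}"

definition torus_leb :: "real measure" where
  "torus_leb = restrict_space lborel torus"

definition trig :: "int \<Rightarrow> real \<Rightarrow> complex" where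
  "trig t u = cis (of_int t * u)"

definition G_le0 :: "real measure \<Rightarrow> (real \<Rightarrow> complex) set" where
  "G_le0 \<mu> = L2_closed_span \<mu> {trig \<tau> | \<tau>. \<tau> \<le> 0}"

definition L2_le0 :: "(real \<Rightarrow> complex) set" where
  "L2_le0 = L2_closed_span torus_leb {trig \<tau> | \<tau>. \<tau> \<le> 0}"

definition L2_gt0 :: "(real \<Rightarrow> complex) set" where
  "L2_gt0 = L2_closed_span torus_leb {trig \<tau> | \<tau>. \<tau> > 0}"

text \<open>Functions of this kind are the complex conjugates of outer functions in the usual sense.\<close>

definition outer :: "(real \<Rightarrow> complex) \<Rightarrow> bool" where
  "outer \<gamma> \<longleftrightarrow> \<gamma> \<in> L2 torus_leb \<and>
     L2_closed_span torus_leb {(\<lambda>u. \<gamma> u * trig \<tau> u) | \<tau>. \<tau> \<le> 0} = L2_le0"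

text \<open>
  The condition $\int |\ln f(u)|\,du < \infty$, with $|\ln 0| = \infty$. Positivity of $f$ almost
  everywhere has to be required separately because HOL sets \<^term>\<open>ln (0::real)\<close> to \<^term>\<open>0::real\<close>.
\<close>

definition log_integrable :: "(real \<Rightarrow> real) \<Rightarrow> bool" where
  "log_integrable f \<longleftrightarrow>
     (AE u in torus_leb. 0 < f u) \<and> integrable torus_leb (\<lambda>u. \<bar>ln (f u)\<bar>)"


section \<open>Stationary sequences and spectral representation\<close>

definition cov :: "'w measure \<Rightarrow> ('w \<Rightarrow> complex) \<Rightarrow> ('w \<Rightarrow> complex) \<Rightarrow> complex" where
  "cov P X Y = (LINT w|P. (X w - (LINT v|P. X v)) * cnj (Y w - (LINT v|P. Y v)))"

definition centered_wide_sense_stationary :: "'w measure \<Rightarrow> (int \<Rightarrow> 'w \<Rightarrow> complex) \<Rightarrow> bool" where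
  "centered_wide_sense_stationary P B \<longleftrightarrow>
     (\<forall>t. B t \<in> L2 P \<and> (LINT w|P. B t w) = 0) \<and>
     (\<exists>K. \<forall>t1 t2. cov P (B t1) (B t2) = K (t1 - t2))"

definition is_spectral_measure ::
    "'w measure \<Rightarrow> (int \<Rightarrow> 'w \<Rightarrow> complex) \<Rightarrow> real measure \<Rightarrow> bool" where
  "is_spectral_measure P B \<mu> \<longleftrightarrow>
     finite_measure \<mu> \<and> sets \<mu> = sets torus_leb \<and>
     (\<forall>t1 t2. cov P (B t1) (B t2) = (LINT u|\<mu>. trig (t1 - t2) u))"

text \<open>
  A complex centered random measure with uncorrelated values and control measure \<open>\<mu>\<close>. The series in
  the countable additivity condition converges in mean square.
\<close>

definition uncorrelated_random_measure ::
    "'w measure \<Rightarrow> real measure \<Rightarrow> (real set \<Rightarrow> 'w \<Rightarrow> complex) \<Rightarrow> bool" where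
  "uncorrelated_random_measure P \<mu> W \<longleftrightarrow>
     (\<forall>A\<in>sets \<mu>. W A \<in> L2 P \<and> (LINT w|P. W A w) = 0 \<and> L2_normsq P (W A) = emeasure \<mu> A) \<and>
     (\<forall>A\<in>sets \<mu>. \<forall>A'\<in>sets \<mu>. A \<inter> A' = {} \<longrightarrow> cov P (W A) (W A') = 0) \<and>
     (\<forall>A :: nat \<Rightarrow> real set. range A \<subseteq> sets \<mu> \<longrightarrow> disjoint_family A \<longrightarrow>
        (\<lambda>n. L2_normsq P (\<lambda>w. W (\<Union>i. A i) w - (\<Sum>i<n. W (A i) w))) \<longlonglongrightarrow> 0)"

definition simple_stoch_integral ::
    "real measure \<Rightarrow> (real set \<Rightarrow> 'w \<Rightarrow> complex) \<Rightarrow> (real \<Rightarrow> complex) \<Rightarrow> 'w \<Rightarrow> complex" where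
  "simple_stoch_integral \<mu> W s w = (\<Sum>y\<in>s ` space \<mu>. y * W (s -` {y} \<inter> space \<mu>) w)"

text \<open>
  \<open>Y\<close> is a version of the integral of \<open>g\<close> with respect to \<open>W\<close>, i.e. of the value at \<open>g\<close> of the
  isometric extension from simple functions to \<open>L2 \<mu>\<close>.
\<close>

definition has_stoch_integral ::
    "'w measure \<Rightarrow> real measure \<Rightarrow> (real set \<Rightarrow> 'w \<Rightarrow> complex) \<Rightarrow>
     (real \<Rightarrow> complex) \<Rightarrow> ('w \<Rightarrow> complex) \<Rightarrow> bool" where
  "has_stoch_integral P \<mu> W g Y \<longleftrightarrow> g \<in> L2 \<mu> \<and> Y \<in> L2 P \<and>
     (\<exists>s. (\<forall>n::nat. simple_function \<mu> (s n)) \<and>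
          (\<lambda>n. L2_normsq \<mu> (\<lambda>u. s n u - g u)) \<longlonglongrightarrow> 0 \<and>
          (\<lambda>n. L2_normsq P (\<lambda>w. simple_stoch_integral \<mu> W (s n) w - Y w)) \<longlonglongrightarrow> 0)"


section \<open>The adaptive approximation problem\<close>

definition energy_function :: "(complex \<Rightarrow> complex) \<Rightarrow> bool" where
  "energy_function l \<longleftrightarrow> l \<in> borel_measurable (restrict_space borel (sphere 0 1))"

text \<open>
  Both functionals below may be infinite, since \<open>l\<close> need not be bounded.
\<close>

definition approx_cost ::
    "real measure \<Rightarrow> (complex \<Rightarrow> complex) \<Rightarrow> (real \<Rightarrow> complex) \<Rightarrow> ennreal" where
  "approx_cost \<mu> l g =
     (\<integral>\<^sup>+ u. ennreal ((norm (g u - 1))\<^sup>2 + (norm (g u))\<^sup>2 * (norm (l (cis u)))\<^sup>2) \<partial>\<mu>)"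

definition adaptivity_loss ::
    "real measure \<Rightarrow> (complex \<Rightarrow> complex) \<Rightarrow> (real \<Rightarrow> complex) \<Rightarrow> ennreal" where
  "adaptivity_loss \<mu> l g =
     (\<integral>\<^sup>+ u. ennreal ((norm (g u - complex_of_real (1 / ((norm (l (cis u)))\<^sup>2 + 1))))\<^sup>2
                  * ((norm (l (cis u)))\<^sup>2 + 1)) \<partial>\<mu>)"

definition ERR_A :: "real measure \<Rightarrow> (complex \<Rightarrow> complex) \<Rightarrow> ennreal" where
  "ERR_A \<mu> l = (INF g\<in>G_le0 \<mu>. adaptivity_loss \<mu> l g)"

definition causal_inverse :: "(real \<Rightarrow> complex) \<Rightarrow> bool" where
  "causal_inverse lam \<longleftrightarrow>
     (\<exists>\<nu> :: nat \<Rightarrow> complex. summable (\<lambda>\<tau>. norm (\<nu> \<tau>)) \<and>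
        (\<forall>u\<in>torus. (\<lambda>\<tau>. \<nu> \<tau> * trig (- int \<tau>) u) sums (1 / lam u)))"

definition preserves_G_le0 :: "real measure \<Rightarrow> (real \<Rightarrow> complex) \<Rightarrow> bool" where
  "preserves_G_le0 \<mu> lam \<longleftrightarrow>
     (\<forall>g\<in>G_le0 \<mu>. (\<lambda>u. lam u * g u) \<in> L2 \<mu> \<longrightarrow> (\<lambda>u. lam u * g u) \<in> G_le0 \<mu>)"

definition g_star ::
    "(real \<Rightarrow> complex) \<Rightarrow> (real \<Rightarrow> complex) \<Rightarrow> (real \<Rightarrow> complex) \<Rightarrow> real \<Rightarrow> complex" where
  "g_star \<gamma> lam Q u = 1 / complex_of_real ((norm (lam u))\<^sup>2) - Q u / (lam u * \<gamma> u)"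

end

theory Submission
  imports Defs
begin

text \<open>
  Let \<open>target = \<gamma> / cnj lam\<close>. Two reductions turn the weighted minimization over \<open>G_le0 \<mu>\<close> into a distance
  problem in \<open>L2 torus_leb\<close>. Completing the square (lemma \<open>cost_identity\<close>) shows that the cost of \<open>g\<close>
  is its adaptivity loss plus a term independent of \<open>g\<close>. And since \<open>f\<close> is the squared modulus of
  \<open>\<gamma>\<close>, multiplication by \<open>\<gamma>\<close> is an isometry from \<open>L2 \<mu>\<close> to \<open>L2 torus_leb\<close>, under which the loss of \<open>g\<close>
  becomes the squared distance from \<open>\<gamma> * lam * g\<close> to \<open>target\<close> (lemma \<open>adaptivity_loss_eq\<close>).

  Outerness of \<open>\<gamma>\<close> says that this isometry maps \<open>G_le0 \<mu>\<close> onto \<open>L2_le0\<close> (lemma \<open>G_le0_iff\<close>). If the loss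
  of \<open>g\<close> in \<open>G_le0 \<mu>\<close> is finite, then \<open>lam * g\<close> is square-integrable, hence again in \<open>G_le0 \<mu>\<close> by
  assumption, and \<open>\<gamma> * lam * g\<close> lies in \<open>L2_le0\<close>. So does \<open>target - Q\<close>, whereas \<open>Q\<close> lies in the orthogonal space
  \<open>L2_gt0\<close>. By Pythagoras the loss is the squared norm of \<open>Q\<close> plus the squared distance from
  \<open>\<gamma> * lam * g\<close> to \<open>target - Q\<close>. The second term vanishes exactly when \<open>\<gamma> * lam * g = target - Q\<close> almost everywhere,
  which is the formula for \<open>g_star \<gamma> lam Q\<close>; and this function belongs to \<open>G_le0 \<mu>\<close> because multiplication by
  \<open>1 / lam\<close>, an absolutely convergent series in nonpositive frequencies, preserves \<open>L2_le0\<close>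
  (lemma \<open>causal_inverse_mult_L2_le0\<close>).

  That \<open>target - Q\<close> lies in \<open>L2_le0\<close>, and not merely in the orthogonal complement of \<open>L2_gt0\<close>, is completeness of
  the trigonometric system (lemma \<open>L2_torus_eq_trig_span\<close>). It is obtained from the Stone-Weierstrass theorem
  on the unit circle and inner regularity. Finally, the process \<open>X\<close> exists because the stochastic integral
  is isometric on simple functions and \<open>L2\<close> is complete (lemma \<open>has_stoch_integral_exists\<close>).
\<close>

section \<open>Square-integrable functions\<close>

lemma borel_measurable_cnj [measurable (raw)]:
  "g \<in> borel_measurable M \<Longrightarrow> (\<lambda>x. cnj (g x)) \<in> borel_measurable M"
  by (rule measurable_compose[OF _ borel_measurable_continuous_onI]) (auto intro: continuous_intros)

lemma L2_measurable [measurable_dest]: "g \<in> L2 M \<Longrightarrow> g \<in> borel_measurable M"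
  by (simp add: L2_def)

lemma L2_normsq_finite: "g \<in> L2 M \<Longrightarrow> L2_normsq M g < \<infinity>"
  by (simp add: L2_def)

lemma L2_normsq_cmult:
  assumes [measurable]: "g \<in> borel_measurable M"
  shows "L2_normsq M (\<lambda>x. c * g x) = ennreal ((norm c)\<^sup>2) * L2_normsq M g"
proof -
  have "L2_normsq M (\<lambda>x. c * g x) = (\<integral>\<^sup>+x. ennreal ((norm c)\<^sup>2) * ennreal ((norm (g x))\<^sup>2) \<partial>M)"
    unfolding L2_normsq_def by (simp add: norm_mult power_mult_distrib ennreal_mult)
  then show ?thesis
    unfolding L2_normsq_def by (simp add: nn_integral_cmult)
qed

lemma norm_add_power2_le:
  fixes a b :: "'a::real_normed_vector"
  shows "(norm (a + b))\<^sup>2 \<le> 2 * (norm a)\<^sup>2 + 2 * (norm b)\<^sup>2"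
proof -
  have "(norm (a + b))\<^sup>2 \<le> (norm a + norm b)\<^sup>2"
    by (intro power_mono norm_triangle_ineq) simp
  also have "\<dots> \<le> (norm a + norm b)\<^sup>2 + (norm a - norm b)\<^sup>2"
    by simp
  also have "\<dots> = 2 * (norm a)\<^sup>2 + 2 * (norm b)\<^sup>2"
    by (simp add: power2_eq_square algebra_simps)
  finally show ?thesis .
qed

text \<open>
  This weak form of the triangle inequality replaces Minkowski's inequality in all limit
  arguments: the constant 2 is harmless there, and no square roots of extended reals occur.
\<close>

lemma L2_normsq_add_le:
  assumes [measurable]: "g \<in> borel_measurable M" "h \<in> borel_measurable M"
  shows "L2_normsq M (\<lambda>x. g x + h x) \<le> 2 * L2_normsq M g + 2 * L2_normsq M h"
proof -
  have "L2_normsq M (\<lambda>x. g x + h x) \<le>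
      (\<integral>\<^sup>+x. 2 * ennreal ((norm (g x))\<^sup>2) + 2 * ennreal ((norm (h x))\<^sup>2) \<partial>M)"
    unfolding L2_normsq_def
  proof (rule nn_integral_mono)
    fix x
    have "ennreal ((norm (g x + h x))\<^sup>2) \<le> ennreal (2 * (norm (g x))\<^sup>2 + 2 * (norm (h x))\<^sup>2)"
      by (intro ennreal_leI norm_add_power2_le)
    then show "ennreal ((norm (g x + h x))\<^sup>2) \<le>
        2 * ennreal ((norm (g x))\<^sup>2) + 2 * ennreal ((norm (h x))\<^sup>2)"
      by (simp add: ennreal_mult ennreal_plus)
  qed
  also have "\<dots> = 2 * L2_normsq M g + 2 * L2_normsq M h"
    unfolding L2_normsq_def by (simp add: nn_integral_add nn_integral_cmult)
  finally show ?thesis .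
qed

lemma L2_normsq_minus_commute: "L2_normsq M (\<lambda>x. g x - h x) = L2_normsq M (\<lambda>x. h x - g x)"
  unfolding L2_normsq_def by (simp add: norm_minus_commute)

lemma L2_normsq_triangle:
  assumes [measurable]: "f \<in> borel_measurable M" "g \<in> borel_measurable M" "h \<in> borel_measurable M"
  shows "L2_normsq M (\<lambda>x. f x - h x) \<le>
    2 * L2_normsq M (\<lambda>x. f x - g x) + 2 * L2_normsq M (\<lambda>x. g x - h x)"
  using L2_normsq_add_le[of "\<lambda>x. f x - g x" M "\<lambda>x. g x - h x"] by simp

lemma L2_cmult: "g \<in> L2 M \<Longrightarrow> (\<lambda>x. c * g x) \<in> L2 M"
  by (auto simp: L2_def L2_normsq_cmult ennreal_mult_less_top)

lemma L2_add: "g \<in> L2 M \<Longrightarrow> h \<in> L2 M \<Longrightarrow> (\<lambda>x. g x + h x) \<in> L2 M"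
  using L2_normsq_add_le[of g M h]
  by (auto simp: L2_def ennreal_mult_less_top intro: le_less_trans)

lemma L2_diff: "g \<in> L2 M \<Longrightarrow> h \<in> L2 M \<Longrightarrow> (\<lambda>x. g x - h x) \<in> L2 M"
  using L2_add[of g M "\<lambda>x. (-1) * h x"] L2_cmult[of h M "-1"] by simp

lemma L2_zero: "(\<lambda>x. 0) \<in> L2 M"
  by (simp add: L2_def L2_normsq_def)

lemma L2_sum: "(\<And>i. i \<in> I \<Longrightarrow> g i \<in> L2 M) \<Longrightarrow> (\<lambda>x. \<Sum>i\<in>I. g i x) \<in> L2 M"
  by (induction I rule: infinite_finite_induct) (auto intro: L2_add L2_zero)

lemma L2_normsq_cong_AE:
  "AE x in M. g x = h x \<Longrightarrow> L2_normsq M g = L2_normsq M h"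
  unfolding L2_normsq_def by (rule nn_integral_cong_AE) auto

lemma L2_normsq_mono_AE:
  "AE x in M. norm (g x) \<le> C * norm (h x) \<Longrightarrow> h \<in> borel_measurable M \<Longrightarrow>
    L2_normsq M g \<le> ennreal (C\<^sup>2) * L2_normsq M h"
proof -
  assume *: "AE x in M. norm (g x) \<le> C * norm (h x)" and [measurable]: "h \<in> borel_measurable M"
  have "L2_normsq M g \<le> (\<integral>\<^sup>+x. ennreal (C\<^sup>2) * ennreal ((norm (h x))\<^sup>2) \<partial>M)"
    unfolding L2_normsq_def
  proof (rule nn_integral_mono_AE, use * in eventually_elim)
    fix x assume "norm (g x) \<le> C * norm (h x)"
    then have "(norm (g x))\<^sup>2 \<le> (C * norm (h x))\<^sup>2"
      by (intro power_mono) auto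
    then show "ennreal ((norm (g x))\<^sup>2) \<le> ennreal (C\<^sup>2) * ennreal ((norm (h x))\<^sup>2)"
      by (simp add: power_mult_distrib ennreal_leI flip: ennreal_mult)
  qed
  then show ?thesis
    by (simp add: L2_normsq_def nn_integral_cmult)
qed

lemma (in finite_measure) L2_bounded:
  assumes "g \<in> borel_measurable M" "\<And>x. x \<in> space M \<Longrightarrow> norm (g x) \<le> C"
  shows "g \<in> L2 M" "L2_normsq M g \<le> ennreal (C\<^sup>2) * emeasure M (space M)"
proof -
  have "L2_normsq M g \<le> ennreal (C\<^sup>2) * L2_normsq M (\<lambda>_. 1)"
    by (rule L2_normsq_mono_AE) (use assms(2) in auto)
  also have "L2_normsq M (\<lambda>_. 1) = emeasure M (space M)"
    by (simp add: L2_normsq_def)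
  finally show *: "L2_normsq M g \<le> ennreal (C\<^sup>2) * emeasure M (space M)" .
  show "g \<in> L2 M"
    using assms(1) * by (auto simp: L2_def emeasure_eq_measure ennreal_mult_less_top intro: le_less_trans)
qed

lemma L2_norm_mult_le:
  assumes "g \<in> L2 M" "h \<in> L2 M"
  shows "(\<integral>\<^sup>+x. norm (g x * cnj (h x)) \<partial>M)\<^sup>2 \<le> L2_normsq M g * L2_normsq M h"
proof -
  have [measurable]: "g \<in> borel_measurable M" "h \<in> borel_measurable M"
    using assms by (auto simp: L2_def)
  show ?thesis
    using Cauchy_Schwarz_nn_integral[of "\<lambda>x. ennreal (norm (g x))" M "\<lambda>x. ennreal (norm (h x))"]
    by (simp add: L2_normsq_def norm_mult ennreal_mult ennreal_power)
qed

lemma L2_integrable_mult: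
  assumes "g \<in> L2 M" "h \<in> L2 M"
  shows "integrable M (\<lambda>x. g x * cnj (h x))"
proof (rule integrableI_bounded)
  have [measurable]: "g \<in> borel_measurable M" "h \<in> borel_measurable M"
    using assms by (auto simp: L2_def)
  show "(\<lambda>x. g x * cnj (h x)) \<in> borel_measurable M"
    by measurable
  have "(\<integral>\<^sup>+x. norm (g x * cnj (h x)) \<partial>M)\<^sup>2 < \<infinity>"
    using L2_norm_mult_le[OF assms] assms
    by (auto simp: L2_def ennreal_mult_less_top intro: le_less_trans)
  then show "(\<integral>\<^sup>+x. norm (g x * cnj (h x)) \<partial>M) < \<infinity>"
    by (auto simp: power2_eq_square ennreal_mult_less_top top.not_eq_extremum)
qed

lemma L2_Cauchy_Schwarz:
  assumes "g \<in> L2 M" "h \<in> L2 M"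
  shows "ennreal ((norm (LINT x|M. g x * cnj (h x)))\<^sup>2) \<le> L2_normsq M g * L2_normsq M h"
proof -
  have "ennreal (norm (LINT x|M. g x * cnj (h x))) \<le> (\<integral>\<^sup>+x. norm (g x * cnj (h x)) \<partial>M)"
    using L2_integrable_mult[OF assms] by (rule integral_norm_bound_ennreal)
  then have "(ennreal (norm (LINT x|M. g x * cnj (h x))))\<^sup>2 \<le> (\<integral>\<^sup>+x. norm (g x * cnj (h x)) \<partial>M)\<^sup>2"
    by (intro power_mono) auto
  also note L2_norm_mult_le[OF assms]
  finally show ?thesis
    by (simp add: ennreal_power)
qed

lemma L2_normsq_eq_inner:
  assumes "g \<in> L2 M"
  shows "L2_normsq M g = ennreal (Re (LINT x|M. g x * cnj (g x)))"
proof -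
  have "integrable M (\<lambda>x. Re (g x * cnj (g x)))"
    using L2_integrable_mult[OF assms assms] by (rule integrable_Re)
  then have "L2_normsq M g = ennreal (LINT x|M. Re (g x * cnj (g x)))"
    unfolding L2_normsq_def
    by (subst nn_integral_eq_integral[symmetric])
       (auto simp: complex_mult_cnj cmod_power2 intro!: nn_integral_cong)
  then show ?thesis
    using integral_Re[OF L2_integrable_mult[OF assms assms]] by simp
qed

lemma L2_inner_commute:
  "(LINT x|M. h x * cnj (g x)) = cnj (LINT x|M. g x * cnj (h x))"
  by (simp add: mult.commute flip: Bochner_Integration.integral_cnj)

lemma L2_normsq_diff_eq_inner:
  assumes g: "g \<in> L2 M" and h: "h \<in> L2 M"
  shows "L2_normsq M (\<lambda>x. g x - h x) =
    ennreal (Re (LINT x|M. g x * cnj (g x)) + Re (LINT x|M. h x * cnj (h x))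
      - 2 * Re (LINT x|M. g x * cnj (h x)))"
proof -
  note [simp] = L2_integrable_mult[OF g g] L2_integrable_mult[OF h h]
    L2_integrable_mult[OF g h] L2_integrable_mult[OF h g]
  have "(LINT x|M. (g x - h x) * cnj (g x - h x)) =
      (LINT x|M. g x * cnj (g x) - g x * cnj (h x) - (h x * cnj (g x) - h x * cnj (h x)))"
    by (intro Bochner_Integration.integral_cong) (auto simp: algebra_simps)
  also have "\<dots> = (LINT x|M. g x * cnj (g x)) - (LINT x|M. g x * cnj (h x))
      - ((LINT x|M. h x * cnj (g x)) - (LINT x|M. h x * cnj (h x)))"
    by simp
  finally show ?thesis
    by (simp add: L2_normsq_eq_inner[OF L2_diff[OF g h]] L2_inner_commute[of M h g])
qed

lemma L2_inner_self_nonneg: "0 \<le> Re (LINT x|M. g x * cnj (g x))"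
proof -
  have "(LINT x|M. g x * cnj (g x)) = (LINT x|M. complex_of_real ((norm (g x))\<^sup>2))"
    by (simp add: complex_norm_square del: of_real_power)
  also have "\<dots> = complex_of_real (LINT x|M. (norm (g x))\<^sup>2)"
    by (rule integral_complex_of_real)
  finally show ?thesis by simp
qed

lemma L2_pythagoras_diff:
  assumes g: "g \<in> L2 M" and h: "h \<in> L2 M" and "(LINT x|M. g x * cnj (h x)) = 0"
  shows "L2_normsq M (\<lambda>x. g x - h x) = L2_normsq M g + L2_normsq M h"
  using assms(3) L2_inner_self_nonneg[of M g] L2_inner_self_nonneg[of M h]
  by (simp add: L2_normsq_diff_eq_inner[OF g h] L2_normsq_eq_inner[OF g] L2_normsq_eq_inner[OF h])

section \<open>Linear spans and closed linear spans\<close>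

lemma complex_lin_span_zero: "(\<lambda>x. 0) \<in> complex_lin_span A"
  unfolding complex_lin_span_def by (auto intro!: exI[of _ "{}"])

lemma complex_lin_span_add_scaled:
  assumes "g \<in> complex_lin_span A" "h \<in> complex_lin_span A"
  shows "(\<lambda>x. a * g x + b * h x) \<in> complex_lin_span A"
proof -
  obtain F c where F: "finite F" "F \<subseteq> A" "g = (\<lambda>x. \<Sum>k\<in>F. c k * k x)"
    using assms(1) unfolding complex_lin_span_def by auto
  obtain G d where G: "finite G" "G \<subseteq> A" "h = (\<lambda>x. \<Sum>k\<in>G. d k * k x)"
    using assms(2) unfolding complex_lin_span_def by auto
  define e where "e k = (if k \<in> F then a * c k else 0) + (if k \<in> G then b * d k else 0)" for k
  have "a * g x + b * h x = (\<Sum>k\<in>F \<union> G. e k * k x)" for x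
  proof -
    have "a * g x = (\<Sum>k\<in>F \<union> G. (if k \<in> F then a * c k else 0) * k x)"
      using F G by (auto simp: sum_distrib_left mult.assoc intro!: sum.mono_neutral_cong_left)
    moreover have "b * h x = (\<Sum>k\<in>F \<union> G. (if k \<in> G then b * d k else 0) * k x)"
      using F G by (auto simp: sum_distrib_left mult.assoc intro!: sum.mono_neutral_cong_left)
    ultimately show ?thesis
      by (simp add: e_def distrib_right sum.distrib)
  qed
  then have "(\<lambda>x. a * g x + b * h x) = (\<lambda>x. \<Sum>k\<in>F \<union> G. e k * k x)" by auto
  moreover have "finite (F \<union> G)" "F \<union> G \<subseteq> A" using F G by auto
  ultimately show ?thesis
    unfolding complex_lin_span_def mem_Collect_eq by blast
qed

lemma complex_lin_span_base: "h \<in> A \<Longrightarrow> h \<in> complex_lin_span A"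
  unfolding complex_lin_span_def by (auto intro!: exI[of _ "{h}"] exI[of _ "\<lambda>_. 1"])

lemma complex_lin_span_cmult: "g \<in> complex_lin_span A \<Longrightarrow> (\<lambda>x. a * g x) \<in> complex_lin_span A"
  using complex_lin_span_add_scaled[of g A g a 0] by simp

lemma complex_lin_span_add:
  "g \<in> complex_lin_span A \<Longrightarrow> h \<in> complex_lin_span A \<Longrightarrow> (\<lambda>x. g x + h x) \<in> complex_lin_span A"
  using complex_lin_span_add_scaled[of g A h 1 1] by simp

lemma complex_lin_span_sum:
  "(\<And>i. i \<in> I \<Longrightarrow> g i \<in> complex_lin_span A) \<Longrightarrow> (\<lambda>x. \<Sum>i\<in>I. g i x) \<in> complex_lin_span A"
  by (induction I rule: infinite_finite_induct) (auto intro: complex_lin_span_zero complex_lin_span_add)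

lemma complex_lin_span_subset_L2:
  assumes "A \<subseteq> L2 M"
  shows "complex_lin_span A \<subseteq> L2 M"
  unfolding complex_lin_span_def using assms by (auto intro!: L2_sum L2_cmult)

lemma closed_span_L2: "g \<in> L2_closed_span M A \<Longrightarrow> g \<in> L2 M"
  by (simp add: L2_closed_span_def)

lemma complex_lin_span_subset_closed_span:
  assumes "A \<subseteq> L2 M"
  shows "complex_lin_span A \<subseteq> L2_closed_span M A"
proof
  fix g assume g: "g \<in> complex_lin_span A"
  moreover have "L2_normsq M (\<lambda>x. g x - g x) = 0" by (simp add: L2_normsq_def)
  ultimately show "g \<in> L2_closed_span M A"
    using complex_lin_span_subset_L2[OF assms] unfolding L2_closed_span_def by force
qed

lemma closed_span_base: "A \<subseteq> L2 M \<Longrightarrow> a \<in> A \<Longrightarrow> a \<in> L2_closed_span M A"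
  by (rule subsetD[OF complex_lin_span_subset_closed_span complex_lin_span_base])

lemma ennreal_quarter_bound:
  fixes a b e :: ennreal
  assumes "e > 0" "a < e / 4" "b < e / 4"
  shows "2 * a + 2 * b < e"
proof (cases "e = \<top>")
  case True
  with assms show ?thesis
    by (auto simp: ennreal_mult_less_top ennreal_top_divide)
next
  case False
  have "2 * a + 2 * b \<le> 2 * (a + b)" by (simp add: distrib_left)
  also have "a + b < e / 4 + e / 4" using assms by (intro add_strict_mono)
  then have "2 * (a + b) < 2 * (e / 4 + e / 4)"
    by (intro ennreal_mult_strict_left_mono) auto
  also have "2 * (e / 4 + e / 4) = e"
    using False by (cases e) (auto simp: divide_ennreal[of _ 4, simplified] ennreal_plus[symmetric] ennreal_mult[symmetric, of 2, simplified] simp del: ennreal_plus)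
  finally show ?thesis .
qed

lemma closed_span_closed:
  assumes A: "A \<subseteq> L2 M" and g: "g \<in> L2 M"
    and approx: "\<And>e. e > 0 \<Longrightarrow> \<exists>h\<in>L2_closed_span M A. L2_normsq M (\<lambda>x. g x - h x) < e"
  shows "g \<in> L2_closed_span M A"
  unfolding L2_closed_span_def
proof (intro CollectI conjI g allI impI)
  fix e :: ennreal assume e: "e > 0"
  then have "e / 4 > 0" by (simp add: ennreal_zero_less_divide)
  then obtain h where h: "h \<in> L2_closed_span M A" "L2_normsq M (\<lambda>x. g x - h x) < e / 4"
    using approx by blast
  then obtain k where k: "k \<in> complex_lin_span A" "L2_normsq M (\<lambda>x. h x - k x) < e / 4"
    using \<open>e / 4 > 0\<close> unfolding L2_closed_span_def by blast
  have "L2_normsq M (\<lambda>x. g x - k x) \<le>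
      2 * L2_normsq M (\<lambda>x. g x - h x) + 2 * L2_normsq M (\<lambda>x. h x - k x)"
    using g h k complex_lin_span_subset_L2[OF A]
    by (intro L2_normsq_triangle) (auto dest: L2_measurable closed_span_L2)
  also have "\<dots> < e"
    using e h(2) k(2) by (rule ennreal_quarter_bound)
  finally show "\<exists>k\<in>complex_lin_span A. L2_normsq M (\<lambda>x. g x - k x) < e"
    using k by blast
qed

lemma closed_span_limit:
  assumes A: "A \<subseteq> L2 M" and g: "g \<in> L2 M"
    and h: "\<And>n::nat. h n \<in> L2_closed_span M A"
    and lim: "(\<lambda>n. L2_normsq M (\<lambda>x. g x - h n x)) \<longlonglongrightarrow> 0"
  shows "g \<in> L2_closed_span M A"
proof (rule closed_span_closed[OF A g])
  fix e :: ennreal assume "e > 0"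
  with lim have "eventually (\<lambda>n. L2_normsq M (\<lambda>x. g x - h n x) < e) sequentially"
    by (rule order_tendstoD)
  then show "\<exists>h\<in>L2_closed_span M A. L2_normsq M (\<lambda>x. g x - h x) < e"
    using h by (auto simp: eventually_sequentially)
qed

lemma closed_span_cong_AE:
  assumes "g \<in> L2_closed_span M A" "AE x in M. g x = h x" "h \<in> borel_measurable M"
  shows "h \<in> L2_closed_span M A"
proof -
  have "L2_normsq M h = L2_normsq M g"
    using assms(2) by (intro L2_normsq_cong_AE) auto
  moreover have "L2_normsq M (\<lambda>x. h x - k x) = L2_normsq M (\<lambda>x. g x - k x)" for k
    using assms(2) by (intro L2_normsq_cong_AE) auto
  ultimately show ?thesis
    using assms(1,3) unfolding L2_closed_span_def by (auto simp: L2_def)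
qed

lemma closed_span_add_scaled:
  assumes A: "A \<subseteq> L2 M"
    and g: "g \<in> L2_closed_span M A" and h: "h \<in> L2_closed_span M A"
  shows "(\<lambda>x. a * g x + b * h x) \<in> L2_closed_span M A"
proof -
  have aux: "\<exists>s :: nat \<Rightarrow> _. (\<forall>n. s n \<in> complex_lin_span A) \<and> (\<lambda>n. L2_normsq M (\<lambda>x. u x - s n x)) \<longlonglongrightarrow> 0"
    if "u \<in> L2_closed_span M A" for u
  proof -
    have "\<exists>s. s \<in> complex_lin_span A \<and> L2_normsq M (\<lambda>x. u x - s x) < ennreal (1 / Suc n)" for n
    proof -
      have "ennreal (1 / Suc n) > 0" by simp
      with that show ?thesis unfolding L2_closed_span_def by blast
    qed
    then obtain s where s: "\<And>n. s n \<in> complex_lin_span A"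
        "\<And>n. L2_normsq M (\<lambda>x. u x - s n x) < ennreal (1 / Suc n)"
      by metis
    have "(\<lambda>n. ennreal (1 / Suc n)) \<longlonglongrightarrow> ennreal 0"
      using LIMSEQ_inverse_real_of_nat by (intro tendsto_ennrealI) (simp add: inverse_eq_divide)
    then have lim: "(\<lambda>n. ennreal (1 / Suc n)) \<longlonglongrightarrow> 0" by simp
    have "(\<lambda>n. L2_normsq M (\<lambda>x. u x - s n x)) \<longlonglongrightarrow> 0"
      by (rule tendsto_sandwich[OF _ _ tendsto_const lim])
         (simp_all add: less_imp_le[OF s(2)] del: of_nat_Suc)
    with s(1) show ?thesis by blast
  qed
  obtain s where s: "\<And>n::nat. s n \<in> complex_lin_span A" "(\<lambda>n. L2_normsq M (\<lambda>x. g x - s n x)) \<longlonglongrightarrow> 0"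
    using aux[OF g] by blast
  obtain t where t: "\<And>n::nat. t n \<in> complex_lin_span A" "(\<lambda>n. L2_normsq M (\<lambda>x. h x - t n x)) \<longlonglongrightarrow> 0"
    using aux[OF h] by blast
  have [measurable]: "g \<in> borel_measurable M" "h \<in> borel_measurable M"
      "\<And>n. s n \<in> borel_measurable M" "\<And>n. t n \<in> borel_measurable M"
    using g h s(1) t(1) complex_lin_span_subset_L2[OF A] by (auto dest: closed_span_L2 L2_measurable)
  define B where "B n = 2 * (ennreal ((norm a)\<^sup>2) * L2_normsq M (\<lambda>x. g x - s n x)) +
    2 * (ennreal ((norm b)\<^sup>2) * L2_normsq M (\<lambda>x. h x - t n x))" for n
  show ?thesis
  proof (rule closed_span_limit[OF A, of _ "\<lambda>n x. a * s n x + b * t n x"])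
    show "(\<lambda>x. a * g x + b * h x) \<in> L2 M"
      using g h by (intro L2_add L2_cmult closed_span_L2)
    show "(\<lambda>x. a * s n x + b * t n x) \<in> L2_closed_span M A" for n
      using s(1) t(1) complex_lin_span_subset_closed_span[OF A]
      by (auto intro: complex_lin_span_add_scaled)
    have "B \<longlonglongrightarrow> 2 * (ennreal ((norm a)\<^sup>2) * 0) + 2 * (ennreal ((norm b)\<^sup>2) * 0)"
      unfolding B_def by (intro tendsto_add ennreal_tendsto_cmult s t) auto
    then have B: "B \<longlonglongrightarrow> 0" by simp
    have le: "L2_normsq M (\<lambda>x. a * g x + b * h x - (a * s n x + b * t n x)) \<le> B n" for n
    proof -
      have "L2_normsq M (\<lambda>x. a * g x + b * h x - (a * s n x + b * t n x)) =
          L2_normsq M (\<lambda>x. a * (g x - s n x) + b * (h x - t n x))"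
        by (simp add: algebra_simps)
      also have "\<dots> \<le> B n"
        unfolding B_def
        using L2_normsq_add_le[of "\<lambda>x. a * (g x - s n x)" M "\<lambda>x. b * (h x - t n x)"]
        by (simp add: L2_normsq_cmult)
      finally show ?thesis .
    qed
    show "(\<lambda>n. L2_normsq M (\<lambda>x. a * g x + b * h x - (a * s n x + b * t n x))) \<longlonglongrightarrow> 0"
      by (rule tendsto_sandwich[OF _ _ tendsto_const B]) (simp_all add: le)
  qed
qed

lemma closed_span_zero: "A \<subseteq> L2 M \<Longrightarrow> (\<lambda>x. 0) \<in> L2_closed_span M A"
  using complex_lin_span_subset_closed_span complex_lin_span_zero by blast

lemma closed_span_sum:
  assumes "A \<subseteq> L2 M" "\<And>i. i \<in> I \<Longrightarrow> g i \<in> L2_closed_span M A"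
  shows "(\<lambda>x. \<Sum>i\<in>I. c i * g i x) \<in> L2_closed_span M A"
  using assms(2)
proof (induction I rule: infinite_finite_induct)
  case (insert i I)
  then show ?case
    using closed_span_add_scaled[OF assms(1), of "g i" "\<lambda>x. \<Sum>i\<in>I. c i * g i x" "c i" 1] by auto
qed (use closed_span_zero[OF assms(1)] in auto)

text \<open>
  Multiplication by \<open>m\<close> is a contraction, hence continuous, so it maps a closed span into a
  closed span as soon as it does so on the generators. The two measures may differ: this is
  what transports one-sided spaces between \<open>L2 \<mu>\<close> and \<open>L2 torus_leb\<close>.
\<close>

lemma closed_span_mult:
  assumes A: "A \<subseteq> L2 M" and B: "B \<subseteq> L2 N"
    and meas: "\<And>g. g \<in> borel_measurable M \<Longrightarrow> (\<lambda>x. m x * g x) \<in> borel_measurable N"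
    and bound: "\<And>g. g \<in> borel_measurable M \<Longrightarrow> L2_normsq N (\<lambda>x. m x * g x) \<le> L2_normsq M g"
    and gen: "\<And>a. a \<in> A \<Longrightarrow> (\<lambda>x. m x * a x) \<in> L2_closed_span N B"
    and g: "g \<in> L2_closed_span M A"
  shows "(\<lambda>x. m x * g x) \<in> L2_closed_span N B"
proof (rule closed_span_closed[OF B])
  have gL: "g \<in> L2 M" using g by (rule closed_span_L2)
  then show "(\<lambda>x. m x * g x) \<in> L2 N"
    using meas bound[of g] by (auto simp: L2_def intro: le_less_trans)
  fix e :: ennreal assume "e > 0"
  then obtain h where h: "h \<in> complex_lin_span A" "L2_normsq M (\<lambda>x. g x - h x) < e"
    using g unfolding L2_closed_span_def by blast
  then obtain F c where F: "finite F" "F \<subseteq> A" "h = (\<lambda>x. \<Sum>k\<in>F. c k * k x)"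
    unfolding complex_lin_span_def by auto
  have "(\<lambda>x. \<Sum>k\<in>F. c k * (m x * k x)) \<in> L2_closed_span N B"
    using F gen by (intro closed_span_sum[OF B]) auto
  also have "(\<lambda>x. \<Sum>k\<in>F. c k * (m x * k x)) = (\<lambda>x. m x * h x)"
    by (auto simp: F sum_distrib_left algebra_simps)
  finally have *: "(\<lambda>x. m x * h x) \<in> L2_closed_span N B" .
  have "(\<lambda>x. g x - h x) \<in> borel_measurable M"
    using gL h complex_lin_span_subset_L2[OF A] by (auto intro!: borel_measurable_diff dest: L2_measurable)
  from bound[OF this] have "L2_normsq N (\<lambda>x. m x * g x - m x * h x) \<le> L2_normsq M (\<lambda>x. g x - h x)"
    by (simp add: algebra_simps)
  with h(2) have "L2_normsq N (\<lambda>x. m x * g x - m x * h x) < e" by simp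
  with * show "\<exists>h\<in>L2_closed_span N B. L2_normsq N (\<lambda>x. m x * g x - h x) < e"
    by (rule_tac bexI[of _ "\<lambda>x. m x * h x"]) auto
qed

text \<open>
  Orthogonality passes from generators to finite combinations by linearity and to their limits by
  the Cauchy-Schwarz inequality.
\<close>

lemma closed_span_orthogonal:
  assumes A: "A \<subseteq> L2 M" and w: "w \<in> L2 M"
    and orth: "\<And>a. a \<in> A \<Longrightarrow> (LINT x|M. w x * cnj (a x)) = 0"
    and v: "v \<in> L2_closed_span M A"
  shows "(LINT x|M. w x * cnj (v x)) = 0"
proof (rule ccontr)
  let ?I = "LINT x|M. w x * cnj (v x)"
  assume "?I \<noteq> 0"
  \<comment> \<open>The summand 1 keeps the divisor below positive when \<open>w\<close> vanishes.\<close>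
  define K where "K = L2_normsq M w + 1"
  have K: "K > 0" "K \<noteq> \<top>" "L2_normsq M w \<le> K"
    using L2_normsq_finite[OF w] by (auto simp: K_def intro: add_nonneg_pos)
  define e where "e = ennreal ((norm ?I)\<^sup>2) / K"
  have "e > 0" using \<open>?I \<noteq> 0\<close> K by (simp add: e_def ennreal_zero_less_divide less_top)
  then obtain h where h: "h \<in> complex_lin_span A" "L2_normsq M (\<lambda>x. v x - h x) < e"
    using v unfolding L2_closed_span_def by blast
  then obtain F c where F: "finite F" "F \<subseteq> A" "h = (\<lambda>x. \<Sum>k\<in>F. c k * k x)"
    unfolding complex_lin_span_def by auto
  have hL: "h \<in> L2 M" and vL: "v \<in> L2 M"
    using h complex_lin_span_subset_L2[OF A] v by (auto dest: closed_span_L2)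
  have int: "k \<in> F \<Longrightarrow> integrable M (\<lambda>x. w x * cnj (k x))" for k
    using F A w by (intro L2_integrable_mult) auto
  have "(LINT x|M. w x * cnj (h x)) = (LINT x|M. (\<Sum>k\<in>F. cnj (c k) * (w x * cnj (k x))))"
    by (simp add: F sum_distrib_left algebra_simps)
  also have "\<dots> = (\<Sum>k\<in>F. cnj (c k) * (LINT x|M. w x * cnj (k x)))"
    using int by (subst Bochner_Integration.integral_sum) auto
  also have "\<dots> = 0"
    using F orth by (intro sum.neutral) auto
  finally have "(LINT x|M. w x * cnj (v x - h x)) = ?I"
    using L2_integrable_mult[OF w vL] L2_integrable_mult[OF w hL]
    by (simp add: algebra_simps)
  then have "ennreal ((norm ?I)\<^sup>2) \<le> L2_normsq M w * L2_normsq M (\<lambda>x. v x - h x)"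
    using L2_Cauchy_Schwarz[OF w L2_diff[OF vL hL]] by simp
  also have "\<dots> \<le> K * L2_normsq M (\<lambda>x. v x - h x)"
    using K by (intro mult_right_mono) auto
  also have "\<dots> < K * e"
    using h(2) K(1) K(2)[unfolded top.not_eq_extremum] by (intro ennreal_mult_strict_left_mono)
  also have "K * e = ennreal ((norm ?I)\<^sup>2)"
    using ennreal_mult_divide_eq[of K "ennreal ((norm ?I)\<^sup>2)"] K(1,2)
    by (simp add: e_def ennreal_times_divide mult.commute)
  finally show False by simp
qed

section \<open>Approximation by simple functions\<close>

text \<open>
  The simple functions can be chosen to converge pointwise with \<open>norm (s n x) \<le> 2 * norm (g x)\<close>,
  so the squared errors are dominated by \<open>9 * (norm (g x))\<^sup>2\<close>.
\<close>

lemma L2_simple_approx: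
  assumes g: "g \<in> L2 M"
  shows "\<exists>s. (\<forall>n::nat. simple_function M (s n)) \<and> (\<forall>n. s n \<in> L2 M) \<and>
    (\<lambda>n. L2_normsq M (\<lambda>x. s n x - g x)) \<longlonglongrightarrow> 0"
proof -
  have [measurable]: "g \<in> borel_measurable M" using g by (rule L2_measurable)
  obtain s where s: "\<And>n. simple_function M (s n)" "\<And>x. x \<in> space M \<Longrightarrow> (\<lambda>n. s n x) \<longlonglongrightarrow> g x"
      "\<And>n x. x \<in> space M \<Longrightarrow> dist (s n x) 0 \<le> 2 * dist (g x) 0"
    using borel_measurable_implies_sequence_metric[of g M 0] by fastforce
  have [measurable]: "s n \<in> borel_measurable M" for n
    using s(1) by (rule borel_measurable_simple_function)
  have "L2_normsq M (s n) \<le> ennreal (2\<^sup>2) * L2_normsq M g" for n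
    by (rule L2_normsq_mono_AE) (use s(3) in auto)
  moreover have "ennreal (2\<^sup>2) * L2_normsq M g < \<infinity>"
    using L2_normsq_finite[OF g] by (simp add: ennreal_mult_less_top)
  ultimately have sL: "s n \<in> L2 M" for n
    unfolding L2_def by (auto intro: le_less_trans)
  have "(\<lambda>n. \<integral>\<^sup>+x. ennreal ((norm (s n x - g x))\<^sup>2) \<partial>M) \<longlonglongrightarrow> (\<integral>\<^sup>+x. 0 \<partial>M)"
  proof (rule nn_integral_dominated_convergence[where w = "\<lambda>x. ennreal 9 * ennreal ((norm (g x))\<^sup>2)"])
    show "(\<integral>\<^sup>+x. ennreal 9 * ennreal ((norm (g x))\<^sup>2) \<partial>M) < \<infinity>"
      using L2_normsq_finite[OF g] by (subst nn_integral_cmult) (auto simp: L2_normsq_def ennreal_mult_less_top)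
    show "AE x in M. ennreal ((norm (s n x - g x))\<^sup>2) \<le> ennreal 9 * ennreal ((norm (g x))\<^sup>2)" for n
    proof (rule AE_I2)
      fix x assume "x \<in> space M"
      then have "norm (s n x - g x) \<le> 3 * norm (g x)"
        using s(3)[of x n] norm_triangle_ineq4[of "s n x" "g x"] by simp
      then have "(norm (s n x - g x))\<^sup>2 \<le> (3 * norm (g x))\<^sup>2"
        by (intro power_mono) auto
      then show "ennreal ((norm (s n x - g x))\<^sup>2) \<le> ennreal 9 * ennreal ((norm (g x))\<^sup>2)"
        by (subst ennreal_mult[symmetric]) (auto simp: power_mult_distrib intro: ennreal_leI)
    qed
    show "AE x in M. (\<lambda>n. ennreal ((norm (s n x - g x))\<^sup>2)) \<longlonglongrightarrow> 0"
    proof (rule AE_I2)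
      fix x assume "x \<in> space M"
      then have "(\<lambda>n. (norm (s n x - g x))\<^sup>2) \<longlonglongrightarrow> (norm (g x - g x))\<^sup>2"
        by (intro tendsto_intros s(2))
      then have "(\<lambda>n. ennreal ((norm (s n x - g x))\<^sup>2)) \<longlonglongrightarrow> ennreal ((norm (g x - g x))\<^sup>2)"
        by (rule tendsto_ennrealI)
      then show "(\<lambda>n. ennreal ((norm (s n x - g x))\<^sup>2)) \<longlonglongrightarrow> 0" by simp
    qed
  qed auto
  then have "(\<lambda>n. L2_normsq M (\<lambda>x. s n x - g x)) \<longlonglongrightarrow> 0"
    by (simp add: L2_normsq_def)
  with s(1) sL show ?thesis by blast
qed

section \<open>Orthogonal generating sets\<close>

lemma L2_orthogonal_sym:
  "(LINT x|M. g x * cnj (h x)) = 0 \<Longrightarrow> (LINT x|M. h x * cnj (g x)) = 0"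
  by (subst L2_inner_commute) simp

text \<open>
  Let \<open>p = p1 + p2\<close> be a combination of generators close to \<open>g\<close>, split according to \<open>A\<close> and \<open>B\<close>.
  Since \<open>g - p1\<close> is orthogonal to \<open>p2\<close>, dropping \<open>p2\<close> does not increase the distance to \<open>g\<close>.
\<close>

lemma closed_span_of_orthogonal_sum:
  assumes A: "A \<subseteq> L2 M" and B: "B \<subseteq> L2 M"
    and orth: "\<And>a b. a \<in> A \<Longrightarrow> b \<in> B \<Longrightarrow> (LINT x|M. a x * cnj (b x)) = 0"
    and g: "g \<in> L2_closed_span M (A \<union> B)"
    and gB: "\<And>b. b \<in> B \<Longrightarrow> (LINT x|M. g x * cnj (b x)) = 0"
  shows "g \<in> L2_closed_span M A"
  unfolding L2_closed_span_def
proof (intro CollectI conjI allI impI)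
  show gL: "g \<in> L2 M" using g by (rule closed_span_L2)
  fix e :: ennreal assume "e > 0"
  then obtain p where p: "p \<in> complex_lin_span (A \<union> B)" "L2_normsq M (\<lambda>x. g x - p x) < e"
    using g unfolding L2_closed_span_def by blast
  then obtain F c where F: "finite F" "F \<subseteq> A \<union> B" "p = (\<lambda>x. \<Sum>h\<in>F. c h * h x)"
    unfolding complex_lin_span_def by auto
  define p1 where "p1 x = (\<Sum>h\<in>F \<inter> A. c h * h x)" for x
  define p2 where "p2 x = (\<Sum>h\<in>F - A. c h * h x)" for x
  have p_eq: "p x = p1 x + p2 x" for x
    unfolding F p1_def p2_def using F(1) by (subst sum.Int_Diff[of F _ A]) auto
  have p1: "p1 \<in> complex_lin_span A"
    unfolding complex_lin_span_def p1_def[abs_def] using F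
    by (intro CollectI exI[of _ "F \<inter> A"] exI[of _ c]) auto
  have p2: "p2 \<in> complex_lin_span B"
    unfolding complex_lin_span_def p2_def[abs_def] using F
    by (intro CollectI exI[of _ "F - A"] exI[of _ c]) auto
  have L: "p1 \<in> L2 M" "p2 \<in> L2 M"
    using subsetD[OF complex_lin_span_subset_L2[OF A] p1]
      subsetD[OF complex_lin_span_subset_L2[OF B] p2] by auto
  have p2': "p2 \<in> L2_closed_span M B"
    using p2 complex_lin_span_subset_closed_span[OF B] by blast
  have "(LINT x|M. p1 x * cnj (b x)) = 0" if "b \<in> B" for b
  proof -
    have "p1 \<in> L2_closed_span M A"
      using p1 complex_lin_span_subset_closed_span[OF A] by blast
    moreover have "b \<in> L2 M" using B that by blast
    moreover have "(LINT x|M. b x * cnj (a x)) = 0" if "a \<in> A" for a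
      using orth[OF that \<open>b \<in> B\<close>] by (rule L2_orthogonal_sym)
    ultimately have "(LINT x|M. b x * cnj (p1 x)) = 0"
      by (rule closed_span_orthogonal[OF A, rotated 2])
    then show ?thesis by (rule L2_orthogonal_sym)
  qed
  then have "(LINT x|M. p1 x * cnj (p2 x)) = 0"
    by (rule closed_span_orthogonal[OF B L(1) _ p2'])
  moreover have "(LINT x|M. g x * cnj (p2 x)) = 0"
    by (rule closed_span_orthogonal[OF B gL gB p2'])
  ultimately have "(LINT x|M. (g x - p1 x) * cnj (p2 x)) = 0"
    using L2_integrable_mult[OF gL L(2)] L2_integrable_mult[OF L] by (simp add: left_diff_distrib)
  from L2_pythagoras_diff[OF L2_diff[OF gL L(1)] L(2) this]
  have "L2_normsq M (\<lambda>x. g x - p x) = L2_normsq M (\<lambda>x. g x - p1 x) + L2_normsq M p2"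
    by (simp add: p_eq diff_diff_eq)
  with p(2) have "L2_normsq M (\<lambda>x. g x - p1 x) < e"
    by (auto intro: le_less_trans[rotated])
  with p1 show "\<exists>h\<in>complex_lin_span A. L2_normsq M (\<lambda>x. g x - h x) < e" by blast
qed

section \<open>Trigonometric polynomials are dense\<close>

lemma space_torus_leb [simp]: "space torus_leb = torus"
  by (simp add: torus_leb_def space_restrict_space)

lemma sets_torus_leb_iff: "A \<in> sets torus_leb \<longleftrightarrow> A \<in> sets borel \<and> A \<subseteq> torus"
  by (auto simp: torus_leb_def sets_restrict_space_iff)

lemma borel_measurable_torus_leb: "g \<in> borel_measurable borel \<Longrightarrow> g \<in> borel_measurable torus_leb"
  by (simp add: torus_leb_def measurable_restrict_space1)

interpretation torus: finite_measure torus_leb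
  by standard (simp add: torus_leb_def emeasure_restrict_space space_restrict_space)

lemma trig_mult: "trig s u * trig t u = trig (s + t) u"
  by (simp add: trig_def cis_mult algebra_simps)

lemma cnj_trig: "cnj (trig t u) = trig (- t) u"
  by (simp add: trig_def cis_cnj)

lemma norm_trig [simp]: "norm (trig t u) = 1"
  by (simp add: trig_def)

lemma borel_measurable_trig [measurable]: "trig t \<in> borel_measurable borel"
  unfolding trig_def by (intro borel_measurable_continuous_onI continuous_intros)

lemma trig_in_L2: "trig t \<in> L2 torus_leb"
  by (rule torus.L2_bounded[of _ 1]) (auto intro: borel_measurable_torus_leb)

lemma integral_trig:
  assumes "t \<noteq> 0"
  shows "(LINT u|torus_leb. trig t u) = 0"
proof -
  define F where "F u = cis (of_int t * u) / (\<i> * of_int t)" for u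
  have "(LINT u|torus_leb. trig t u) = (LINT u|lborel. indicator torus u *\<^sub>R trig t u)"
    unfolding torus_leb_def by (subst integral_restrict_space) auto
  also have "\<dots> = (LINT u|lborel. indicator {-pi..pi} u *\<^sub>R trig t u)"
  proof (rule integral_cong_AE)
    have "AE u in lborel. u \<noteq> pi" by (rule AE_lborel_singleton)
    then show "AE u in lborel. indicator torus u *\<^sub>R trig t u = indicator {-pi..pi} u *\<^sub>R trig t u"
      by eventually_elim (auto simp: indicator_def)
  qed auto
  also have "\<dots> = F pi - F (-pi)"
  proof (rule integral_FTC_Icc)
    show "continuous_on {-pi..pi} (trig t)"
      unfolding trig_def by (intro continuous_intros)
    fix u :: real
    show "(F has_vector_derivative trig t u) (at u within {-pi..pi})"
      unfolding F_def trig_def using assms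
      by (auto intro!: derivative_eq_intros simp: has_vector_derivative_def scaleR_conv_of_real field_simps)
  qed simp
  also have "\<dots> = 0"
    using sin_zero_iff_int2[of "of_int t * pi"] by (auto simp: F_def complex_eq_iff cis.ctr)
  finally show ?thesis .
qed

lemma trig_orthogonal: "s \<noteq> t \<Longrightarrow> (LINT u|torus_leb. trig s u * cnj (trig t u)) = 0"
  by (simp add: cnj_trig trig_mult integral_trig)

abbreviation trig_polys :: "(real \<Rightarrow> complex) set" where
  "trig_polys \<equiv> complex_lin_span (range trig)"

lemma trig_poly_mult:
  assumes "g \<in> trig_polys" "h \<in> trig_polys"
  shows "(\<lambda>u. g u * h u) \<in> trig_polys"
proof -
  obtain F c where F: "finite F" "F \<subseteq> range trig" "g = (\<lambda>x. \<Sum>k\<in>F. c k * k x)"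
    using assms(1) unfolding complex_lin_span_def by auto
  obtain G d where G: "finite G" "G \<subseteq> range trig" "h = (\<lambda>x. \<Sum>k\<in>G. d k * k x)"
    using assms(2) unfolding complex_lin_span_def by auto
  have "(\<lambda>u. \<Sum>k\<in>F. \<Sum>j\<in>G. (c k * d j) * (k u * j u)) \<in> trig_polys"
  proof (intro complex_lin_span_sum complex_lin_span_cmult complex_lin_span_base)
    fix k j assume "k \<in> F" "j \<in> G"
    then have "k \<in> range trig" "j \<in> range trig" using F(2) G(2) by blast+
    then obtain s t where "k = trig s" "j = trig t" by blast
    then show "(\<lambda>u. k u * j u) \<in> range trig" by (auto simp: trig_mult)
  qed
  also have "(\<lambda>u. \<Sum>k\<in>F. \<Sum>j\<in>G. (c k * d j) * (k u * j u)) = (\<lambda>u. g u * h u)"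
    by (auto simp: F G sum_product mult_ac)
  finally show ?thesis .
qed

text \<open>
  On the unit circle the coordinates are \<open>(trig 1 + trig (-1)) / 2\<close> and
  \<open>(trig 1 - trig (-1)) / (2 * \<i>)\<close>, and trigonometric polynomials form an algebra.
\<close>

lemma real_polynomial_cis_trig_poly:
  assumes "real_polynomial_function p"
  shows "(\<lambda>u. complex_of_real (p (cis u))) \<in> trig_polys"
  using assms
proof induction
  case (linear p)
  then interpret bounded_linear p .
  define a where "a = complex_of_real (p 1)"
  define b where "b = complex_of_real (p \<i>)"
  have "complex_of_real (p (cis u)) = ((a - \<i> * b) / 2) * trig 1 u + ((a + \<i> * b) / 2) * trig (-1) u" for u
  proof -
    have "cis u = cos u *\<^sub>R 1 + sin u *\<^sub>R \<i>" by (simp add: complex_eq_iff)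
    then have "p (cis u) = cos u * p 1 + sin u * p \<i>" by (simp add: add scaleR)
    then show ?thesis
      by (simp add: complex_eq_iff trig_def a_def b_def field_simps)
  qed
  moreover have "(\<lambda>u. ((a - \<i> * b) / 2) * trig 1 u + ((a + \<i> * b) / 2) * trig (-1) u) \<in> trig_polys"
    by (intro complex_lin_span_add_scaled complex_lin_span_base rangeI)
  ultimately show ?case by simp
next
  case (const c)
  have "(\<lambda>u. complex_of_real c * trig 0 u) \<in> trig_polys"
    by (intro complex_lin_span_cmult complex_lin_span_base rangeI)
  moreover have "trig 0 u = 1" for u by (simp add: trig_def)
  ultimately show ?case by simp
next
  case (add p q)
  from complex_lin_span_add[OF add.IH] show ?case by simp
next
  case (mult p q)
  from trig_poly_mult[OF mult.IH] show ?case by simp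
qed

abbreviation trig_span :: "(real \<Rightarrow> complex) set" where
  "trig_span \<equiv> L2_closed_span torus_leb (range trig)"

lemma range_trig_L2: "range trig \<subseteq> L2 torus_leb"
  using trig_in_L2 by auto

lemma uniform_limit_in_closed_span:
  assumes "finite_measure M" and A: "A \<subseteq> L2 M" and g: "g \<in> borel_measurable M"
    and approx: "\<And>e. e > 0 \<Longrightarrow> \<exists>h\<in>L2_closed_span M A. \<forall>x\<in>space M. norm (g x - h x) \<le> e"
  shows "g \<in> L2_closed_span M A"
proof -
  interpret finite_measure M by fact
  have "\<exists>h. h \<in> L2_closed_span M A \<and> (\<forall>x\<in>space M. norm (g x - h x) \<le> 1 / Suc n)" for n
    using approx[of "1 / Suc n"] by auto
  then obtain h where h: "\<And>n. h n \<in> L2_closed_span M A"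
      "\<And>n x. x \<in> space M \<Longrightarrow> norm (g x - h n x) \<le> 1 / Suc n"
    by metis
  have meas: "(\<lambda>x. g x - h n x) \<in> borel_measurable M" for n
    using g h(1) by (intro borel_measurable_diff) (auto dest: closed_span_L2 L2_measurable)
  note b = L2_bounded[OF meas h(2)]
  have "(\<lambda>x. (g x - h 0 x) + h 0 x) \<in> L2 M"
    by (intro L2_add b closed_span_L2[OF h(1)])
  then have gL: "g \<in> L2 M" by simp
  have "(\<lambda>n. ennreal ((1 / Suc n)\<^sup>2 * measure M (space M))) \<longlonglongrightarrow> ennreal (0\<^sup>2 * measure M (space M))"
    using LIMSEQ_inverse_real_of_nat
    by (intro tendsto_ennrealI tendsto_intros) (simp add: inverse_eq_divide)
  then have lim: "(\<lambda>n. ennreal ((1 / Suc n)\<^sup>2) * emeasure M (space M)) \<longlonglongrightarrow> 0"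
    by (simp add: emeasure_eq_measure ennreal_mult)
  show ?thesis
    by (rule closed_span_limit[where h = h, OF A gL h(1)])
       (rule tendsto_sandwich[OF _ _ tendsto_const lim], simp_all add: b(2) del: of_nat_Suc)
qed

text \<open>
  Stone-Weierstrass on the unit circle. Composing with \<open>cis\<close> encodes periodicity: a continuous
  function on the interval \<open>torus\<close> itself need not be a uniform limit of trigonometric polynomials.
\<close>

lemma continuous_cis_in_trig_span:
  fixes \<phi> :: "complex \<Rightarrow> real"
  assumes \<phi>: "continuous_on UNIV \<phi>"
  shows "(\<lambda>u. complex_of_real (\<phi> (cis u))) \<in> trig_span"
proof (rule uniform_limit_in_closed_span[OF torus.finite_measure_axioms range_trig_L2])
  show "(\<lambda>u. complex_of_real (\<phi> (cis u))) \<in> borel_measurable torus_leb"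
    by (intro borel_measurable_torus_leb borel_measurable_continuous_onI continuous_on_of_real
        continuous_on_compose2[OF \<phi> continuous_on_cis] continuous_on_id) auto
  fix e :: real assume "e > 0"
  then obtain p where p: "real_polynomial_function p" "\<And>z. z \<in> sphere 0 1 \<Longrightarrow> \<bar>\<phi> z - p z\<bar> < e"
    using Stone_Weierstrass_real_polynomial_function[OF compact_sphere[of 0 1]
        continuous_on_subset[OF \<phi> subset_UNIV]] by blast
  have "norm (complex_of_real (\<phi> (cis u)) - complex_of_real (p (cis u))) \<le> e" for u
    using p(2)[of "cis u"] by (simp flip: of_real_diff)
  moreover have "(\<lambda>u. complex_of_real (p (cis u))) \<in> trig_span"
    using real_polynomial_cis_trig_poly[OF p(1)]
      complex_lin_span_subset_closed_span[OF range_trig_L2] by blast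
  ultimately show "\<exists>h\<in>trig_span. \<forall>u\<in>space torus_leb. norm (complex_of_real (\<phi> (cis u)) - h u) \<le> e"
    by (intro bexI[where x = "\<lambda>u. complex_of_real (p (cis u))"]) auto
qed

text \<open>
  The indicator is the pointwise limit of the continuous functions
  \<open>max 0 (1 - n * infdist z K)\<close>, which take values between 0 and 1.
\<close>

lemma closed_cis_indicator_in_trig_span:
  assumes K: "closed K"
  shows "(\<lambda>u. indicator K (cis u) :: complex) \<in> trig_span"
proof (cases "K = {}")
  case True
  then show ?thesis using closed_span_zero[OF range_trig_L2] by simp
next
  case False
  define \<phi> where "\<phi> n z = max 0 (1 - real n * infdist z K)" for n z
  have \<phi>: "continuous_on UNIV (\<phi> n)" for n
    unfolding \<phi>_def by (intro continuous_intros)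
  have [measurable]: "K \<in> sets borel" using K by (rule borel_closed)
  have [measurable]: "cis \<in> borel_measurable borel"
    by (intro borel_measurable_continuous_onI continuous_intros)
  have meas: "(\<lambda>u. complex_of_real (\<phi> n (cis u))) \<in> borel_measurable torus_leb" for n
    using continuous_cis_in_trig_span[OF \<phi>] by (rule L2_measurable[OF closed_span_L2])
  have meas_ind: "(\<lambda>u. indicator K (cis u) :: complex) \<in> borel_measurable torus_leb"
    by (intro borel_measurable_torus_leb) measurable
  have lim: "(\<lambda>n. \<phi> n z) \<longlonglongrightarrow> indicator K z" for z
  proof (cases "z \<in> K")
    case True
    then show ?thesis by (simp add: \<phi>_def)
  next
    case False
    then have pos: "infdist z K > 0"
      using K \<open>K \<noteq> {}\<close> by (simp add: infdist_pos_not_in_closed)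
    obtain N where N: "real N * infdist z K > 1"
      using reals_Archimedean3[OF pos] by blast
    have "\<phi> n z = 0" if "n \<ge> N" for n
    proof -
      have "real n * infdist z K \<ge> real N * infdist z K"
        using that pos by (intro mult_right_mono) auto
      with N show ?thesis by (simp add: \<phi>_def)
    qed
    then have "eventually (\<lambda>n. \<phi> n z = 0) sequentially"
      by (auto simp: eventually_sequentially)
    then show ?thesis using False by (simp add: tendsto_eventually)
  qed
  have \<phi>_bound: "0 \<le> \<phi> n z" "\<phi> n z \<le> 1" for n z
    by (auto simp: \<phi>_def infdist_nonneg)
  have bound: "\<bar>indicator K z - \<phi> n z\<bar> \<le> 1" for n z
    using \<phi>_bound[of n z] by (auto simp: indicator_def)
  have norm_eq: "norm (indicator K (cis u) - complex_of_real (\<phi> n (cis u))) =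
      \<bar>indicator K (cis u) - \<phi> n (cis u)\<bar>" for n u
  proof -
    have "(indicator K (cis u) :: complex) = complex_of_real (indicator K (cis u))"
      by (simp add: indicator_def)
    then show ?thesis by (simp only: flip: of_real_diff) (simp only: norm_of_real)
  qed
  have "(\<lambda>n. \<integral>\<^sup>+u. ennreal ((norm (indicator K (cis u) - complex_of_real (\<phi> n (cis u))))\<^sup>2) \<partial>torus_leb)
      \<longlonglongrightarrow> (\<integral>\<^sup>+u. 0 \<partial>torus_leb)"
  proof (rule nn_integral_dominated_convergence[where w = "\<lambda>_. 1"])
    show "(\<lambda>u. ennreal ((norm (indicator K (cis u) - complex_of_real (\<phi> n (cis u))))\<^sup>2))
        \<in> borel_measurable torus_leb" for n
      using meas meas_ind by measurable
    show "(\<integral>\<^sup>+u. 1 \<partial>torus_leb) < \<infinity>"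
      by (simp add: torus.emeasure_eq_measure del: space_torus_leb)
    show "AE u in torus_leb. ennreal ((norm (indicator K (cis u) - complex_of_real (\<phi> n (cis u))))\<^sup>2) \<le> 1" for n
      using bound by (auto simp: norm_eq abs_square_le_1 simp flip: ennreal_1 intro!: ennreal_leI)
    show "AE u in torus_leb. (\<lambda>n. ennreal ((norm (indicator K (cis u) - complex_of_real (\<phi> n (cis u))))\<^sup>2)) \<longlonglongrightarrow> 0"
    proof (rule AE_I2)
      fix u
      have "(\<lambda>n. \<bar>indicator K (cis u) - \<phi> n (cis u)\<bar>\<^sup>2) \<longlonglongrightarrow> \<bar>indicator K (cis u) - indicator K (cis u)\<bar>\<^sup>2"
        by (intro tendsto_intros lim)
      then have "(\<lambda>n. ennreal (\<bar>indicator K (cis u) - \<phi> n (cis u)\<bar>\<^sup>2)) \<longlonglongrightarrow> ennreal 0"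
        by (intro tendsto_ennrealI) simp
      then show "(\<lambda>n. ennreal ((norm (indicator K (cis u) - complex_of_real (\<phi> n (cis u))))\<^sup>2)) \<longlonglongrightarrow> 0"
        by (simp only: norm_eq ennreal_0)
    qed
  qed auto
  then have *: "(\<lambda>n. L2_normsq torus_leb (\<lambda>u. indicator K (cis u) - complex_of_real (\<phi> n (cis u)))) \<longlonglongrightarrow> 0"
    by (simp add: L2_normsq_def)
  show ?thesis
  proof (rule closed_span_limit[OF range_trig_L2 _ _ *])
    show "(\<lambda>u. indicator K (cis u) :: complex) \<in> L2 torus_leb"
      using meas_ind by (rule torus.L2_bounded[of _ 1]) (auto simp: indicator_def)
  qed (rule continuous_cis_in_trig_span[OF \<phi>])
qed

text \<open>
  The image of Lebesgue measure on the circle is a finite Borel measure on the complex plane, hence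
  inner regular: \<open>C\<close> is approximated from inside by compact sets.
\<close>

lemma borel_cis_indicator_in_trig_span:
  assumes C [measurable]: "C \<in> sets borel"
  shows "(\<lambda>u. indicator C (cis u) :: complex) \<in> trig_span"
proof (rule closed_span_closed[OF range_trig_L2])
  have [measurable]: "cis \<in> borel_measurable borel"
    by (intro borel_measurable_continuous_onI continuous_intros)
  have cis_meas: "cis \<in> borel_measurable torus_leb"
    by (intro borel_measurable_torus_leb) measurable
  have "(\<lambda>u. indicator C (cis u) :: complex) \<in> borel_measurable torus_leb"
    by (intro borel_measurable_torus_leb) measurable
  then show "(\<lambda>u. indicator C (cis u) :: complex) \<in> L2 torus_leb"
    by (rule torus.L2_bounded[of _ 1]) (auto simp: indicator_def)
  define \<sigma> where "\<sigma> = distr torus_leb borel cis"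
  interpret \<sigma>: finite_measure \<sigma>
    unfolding \<sigma>_def using cis_meas by (rule torus.finite_measure_distr)
  have \<sigma>_sets [simp]: "sets \<sigma> = sets borel" by (simp add: \<sigma>_def)
  fix e :: ennreal assume e: "e > 0"
  have "\<exists>K. K \<subseteq> C \<and> compact K \<and> emeasure \<sigma> (C - K) < e"
  proof (rule ccontr)
    assume "\<not> ?thesis"
    then have large: "emeasure \<sigma> (C - K) \<ge> e" if "K \<subseteq> C" "compact K" for K
      using that by (auto simp: not_less)
    define \<K> where "\<K> = {K. K \<subseteq> C \<and> compact K}"
    have "{} \<in> \<K>" by (simp add: \<K>_def)
    have le: "emeasure \<sigma> K + e \<le> emeasure \<sigma> C" if "K \<in> \<K>" for K
    proof -
      have "K \<in> sets borel" using that by (simp add: \<K>_def borel_compact)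
      then have "emeasure \<sigma> C = emeasure \<sigma> K + emeasure \<sigma> (C - K)"
        using that by (subst plus_emeasure) (auto simp: \<K>_def Un_absorb1)
      then show ?thesis using large[of K] that by (simp add: \<K>_def add_left_mono)
    qed
    have "emeasure \<sigma> C + e = (SUP K\<in>\<K>. emeasure \<sigma> K) + e"
      using inner_regular[OF \<sigma>_sets, of C] C \<sigma>.emeasure_finite by (simp add: \<K>_def)
    also have "\<dots> = (SUP K\<in>\<K>. emeasure \<sigma> K + e)"
      using \<open>{} \<in> \<K>\<close> by (subst ennreal_SUP_add_left) auto
    also have "\<dots> \<le> emeasure \<sigma> C"
      using le by (rule SUP_least)
    finally have "emeasure \<sigma> C + e \<le> emeasure \<sigma> C + 0" by simp
    with e show False
      using ennreal_add_left_cancel_le[of "emeasure \<sigma> C" e 0] \<sigma>.emeasure_finite[of C] by simp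
  qed
  then obtain K where K: "K \<subseteq> C" "compact K" "emeasure \<sigma> (C - K) < e" by blast
  have [measurable]: "K \<in> sets borel" using K by (simp add: borel_compact)
  have "L2_normsq torus_leb (\<lambda>u. indicator C (cis u) - indicator K (cis u)) =
      (\<integral>\<^sup>+u. indicator (C - K) (cis u) \<partial>torus_leb)"
    unfolding L2_normsq_def using K(1) by (intro nn_integral_cong) (auto simp: indicator_def)
  also have "\<dots> = (\<integral>\<^sup>+z. indicator (C - K) z \<partial>\<sigma>)"
    unfolding \<sigma>_def by (rule nn_integral_distr[OF cis_meas, symmetric]) measurable
  also have "\<dots> = emeasure \<sigma> (C - K)"
    by (rule nn_integral_indicator) simp
  finally have "L2_normsq torus_leb (\<lambda>u. indicator C (cis u) - indicator K (cis u)) < e"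
    using K(3) by simp
  moreover have "(\<lambda>u. indicator K (cis u) :: complex) \<in> trig_span"
    using K(2) by (intro closed_cis_indicator_in_trig_span compact_imp_closed)
  ultimately show "\<exists>h\<in>trig_span. L2_normsq torus_leb (\<lambda>u. indicator C (cis u) - h u) < e"
    by (rule bexI[where x = "\<lambda>u. indicator K (cis u)"])
qed

text \<open>
  Every Borel subset of \<open>torus\<close> is cut out of \<open>torus\<close> by the preimage under \<open>cis\<close> of a Borel set of the
  plane, because \<open>cis\<close> has a measurable left inverse \<open>r\<close> on \<open>torus\<close>.
\<close>

lemma indicator_in_trig_span:
  assumes A: "A \<in> sets torus_leb"
  shows "(indicator A :: real \<Rightarrow> complex) \<in> trig_span"
proof -
  \<comment> \<open>The endpoint of \<open>torus\<close> is \<open>-pi\<close>, whereas \<open>Arg (-1) = pi\<close>; the half-line through \<open>-1\<close> is also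
    where \<open>Arg\<close> is discontinuous.\<close>
  define r where "r z = (if z \<in> \<real>\<^sub>\<le>\<^sub>0 then -pi else Arg z)" for z
  have "r \<in> borel_measurable borel"
    unfolding r_def
    by (intro borel_measurable_continuous_on_if continuous_on_Arg borel_closed
        closed_nonpos_Reals_complex continuous_on_const)
  moreover have "A \<in> sets borel" using A by (simp add: sets_torus_leb_iff)
  ultimately have C: "r -` A \<in> sets borel"
    using measurable_sets[of r borel borel A] by simp
  have r_cis: "r (cis u) = u" if "u \<in> torus" for u
  proof (cases "u = -pi")
    case True
    then show ?thesis by (simp add: r_def complex_nonpos_Reals_iff)
  next
    case False
    then have u: "u \<in> {-pi<..<pi}" using that by auto
    have "cis u \<notin> \<real>\<^sub>\<le>\<^sub>0"
    proof
      assume "cis u \<in> \<real>\<^sub>\<le>\<^sub>0"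
      then have "sin u = 0" "cos u \<le> 0" by (auto simp: complex_nonpos_Reals_iff)
      then have "u = 0" using sin_eq_0_pi[of u] u by auto
      with \<open>cos u \<le> 0\<close> show False by simp
    qed
    then show ?thesis using u by (simp add: r_def Arg_cis)
  qed
  show ?thesis
  proof (rule closed_span_cong_AE[OF borel_cis_indicator_in_trig_span[OF C]])
    show "AE u in torus_leb. (indicator (r -` A) (cis u) :: complex) = indicator A u"
      by (rule AE_I2) (simp add: r_cis indicator_def)
    show "(indicator A :: real \<Rightarrow> complex) \<in> borel_measurable torus_leb"
      using A by simp
  qed
qed

lemma L2_subset_closed_span_if_indicators:
  assumes A: "A \<subseteq> L2 M"
    and ind: "\<And>S. S \<in> sets M \<Longrightarrow> (indicator S :: 'a \<Rightarrow> complex) \<in> L2_closed_span M A"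
  shows "L2 M \<subseteq> L2_closed_span M A"
proof
  fix g assume g: "g \<in> L2 M"
  then obtain s where s: "\<And>n::nat. simple_function M (s n)" "\<And>n. s n \<in> L2 M"
      "(\<lambda>n. L2_normsq M (\<lambda>x. s n x - g x)) \<longlonglongrightarrow> 0"
    using L2_simple_approx by blast
  show "g \<in> L2_closed_span M A"
  proof (rule closed_span_limit[OF A g])
    show "(\<lambda>n. L2_normsq M (\<lambda>x. g x - s n x)) \<longlonglongrightarrow> 0"
      using s(3) by (simp add: L2_normsq_minus_commute[of M g])
    fix n
    have "(\<lambda>x. \<Sum>y\<in>s n ` space M. y * indicator (s n -` {y} \<inter> space M) x) \<in> L2_closed_span M A"
      using s(1) by (intro closed_span_sum[OF A] ind simple_functionD)
    moreover have "(\<Sum>y\<in>s n ` space M. y * indicator (s n -` {y} \<inter> space M) x) = s n x"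
      if "x \<in> space M" for x
    proof -
      have "(\<Sum>y\<in>s n ` space M. y * indicator (s n -` {y} \<inter> space M) x) =
          (\<Sum>y\<in>s n ` space M. if y = s n x then y else 0)"
        using that by (intro sum.cong) (auto simp: indicator_def)
      then show ?thesis
        using that simple_functionD(1)[OF s(1)] by (simp add: sum.delta)
    qed
    ultimately show "s n \<in> L2_closed_span M A"
      by (rule closed_span_cong_AE[OF _ AE_I2 L2_measurable[OF s(2)]])
  qed
qed

text \<open>
  Completeness of the trigonometric system: indicators are in the span, hence simple functions, hence
  all of \<open>L2 torus_leb\<close>.
\<close>

lemma L2_torus_eq_trig_span: "L2 torus_leb = trig_span"
  using L2_subset_closed_span_if_indicators[OF range_trig_L2 indicator_in_trig_span]
  by (auto dest: closed_span_L2)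

section \<open>Functions with one-sided spectrum\<close>

lemma trig_le0_L2: "{trig \<tau> | \<tau>. \<tau> \<le> 0} \<subseteq> L2 torus_leb"
  and trig_gt0_L2: "{trig \<tau> | \<tau>. \<tau> > 0} \<subseteq> L2 torus_leb"
  using trig_in_L2 by auto

lemma L2_le0_orthogonal_L2_gt0:
  assumes g: "g \<in> L2_le0" and h: "h \<in> L2_gt0"
  shows "(LINT u|torus_leb. g u * cnj (h u)) = 0"
proof -
  have gL: "g \<in> L2 torus_leb" using g unfolding L2_le0_def by (rule closed_span_L2)
  have "(LINT u|torus_leb. g u * cnj (trig \<tau> u)) = 0" if "\<tau> > 0" for \<tau>
  proof -
    have "(LINT u|torus_leb. trig \<tau> u * cnj (g u)) = 0"
      by (rule closed_span_orthogonal[OF trig_le0_L2 trig_in_L2 _ g[unfolded L2_le0_def]])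
        (use that in \<open>auto intro!: trig_orthogonal\<close>)
    then show ?thesis by (rule L2_orthogonal_sym)
  qed
  then show ?thesis
    by (intro closed_span_orthogonal[OF trig_gt0_L2 gL _ h[unfolded L2_gt0_def]]) auto
qed

text \<open>
  The two one-sided spaces together exhaust \<open>L2 torus_leb\<close>, so \<open>L2_le0\<close> contains the whole
  orthogonal complement of \<open>L2_gt0\<close>.
\<close>

lemma orthogonal_L2_gt0_imp_L2_le0:
  assumes g: "g \<in> L2 torus_leb"
    and orth: "\<And>\<tau>. \<tau> > 0 \<Longrightarrow> (LINT u|torus_leb. g u * cnj (trig \<tau> u)) = 0"
  shows "g \<in> L2_le0"
  unfolding L2_le0_def
proof (rule closed_span_of_orthogonal_sum[OF trig_le0_L2 trig_gt0_L2])
  have "range trig = {trig \<tau> | \<tau>. \<tau> \<le> 0} \<union> {trig \<tau> | \<tau>. \<tau> > 0}"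
    by force
  then show "g \<in> L2_closed_span torus_leb ({trig \<tau> | \<tau>. \<tau> \<le> 0} \<union> {trig \<tau> | \<tau>. \<tau> > 0})"
    using g by (simp add: L2_torus_eq_trig_span)
qed (use orth in \<open>auto intro!: trig_orthogonal\<close>)

text \<open>
  The reciprocal of \<open>lam\<close> is a pointwise limit of trigonometric polynomials.
\<close>

lemma causal_inverse_measurable:
  assumes "causal_inverse lam"
  shows "lam \<in> borel_measurable torus_leb"
proof -
  obtain \<nu> where \<nu>: "\<And>u. u \<in> torus \<Longrightarrow> (\<lambda>\<tau>. \<nu> \<tau> * trig (- int \<tau>) u) sums (1 / lam u)"
    using assms unfolding causal_inverse_def by blast
  have "(\<lambda>u. 1 / lam u) \<in> borel_measurable torus_leb"
  proof (rule borel_measurable_LIMSEQ_metric[where f = "\<lambda>n u. \<Sum>\<tau><n. \<nu> \<tau> * trig (- int \<tau>) u"])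
    show "(\<lambda>u. \<Sum>\<tau><n. \<nu> \<tau> * trig (- int \<tau>) u) \<in> borel_measurable torus_leb" for n
      by (intro borel_measurable_torus_leb) measurable
  qed (use \<nu> in \<open>auto simp: sums_def\<close>)
  then have "(\<lambda>u. 1 / (1 / lam u)) \<in> borel_measurable torus_leb"
    by measurable
  then show ?thesis by simp
qed

text \<open>
  The series of \<open>1 / lam\<close> has only nonpositive frequencies and converges uniformly, so \<open>1 / lam\<close> times a
  generator of \<open>L2_le0\<close> is a uniform limit of combinations of generators.
\<close>

lemma causal_inverse_mult_L2_le0:
  assumes lam: "causal_inverse lam" and ge1: "\<And>u. u \<in> torus \<Longrightarrow> norm (lam u) \<ge> 1"
    and g: "g \<in> L2_le0"
  shows "(\<lambda>u. 1 / lam u * g u) \<in> L2_le0"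
  unfolding L2_le0_def
proof (rule closed_span_mult[OF trig_le0_L2 trig_le0_L2 _ _ _ g[unfolded L2_le0_def]])
  have [measurable]: "lam \<in> borel_measurable torus_leb"
    using lam by (rule causal_inverse_measurable)
  show "(\<lambda>u. 1 / lam u * h u) \<in> borel_measurable torus_leb"
    if [measurable]: "h \<in> borel_measurable torus_leb" for h by measurable
  show "L2_normsq torus_leb (\<lambda>u. 1 / lam u * h u) \<le> L2_normsq torus_leb h"
    if "h \<in> borel_measurable torus_leb" for h
  proof -
    have "AE u in torus_leb. norm (1 / lam u * h u) \<le> 1 * norm (h u)"
    proof (rule AE_I2)
      fix u assume "u \<in> space torus_leb"
      then have "norm (lam u) \<ge> 1" using ge1 by simp
      then have "norm (1 / lam u) \<le> 1" by (auto simp: norm_divide divide_le_eq_1)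
      then show "norm (1 / lam u * h u) \<le> 1 * norm (h u)"
        unfolding norm_mult by (intro mult_right_mono) auto
    qed
    from L2_normsq_mono_AE[OF this that] show ?thesis by simp
  qed
  obtain \<nu> where \<nu>: "summable (\<lambda>\<tau>. norm (\<nu> \<tau>))"
      "\<And>u. u \<in> torus \<Longrightarrow> (\<lambda>\<tau>. \<nu> \<tau> * trig (- int \<tau>) u) sums (1 / lam u)"
    using lam unfolding causal_inverse_def by blast
  fix a assume "a \<in> {trig \<tau> | \<tau>. \<tau> \<le> 0}"
  then obtain \<tau> where a: "a = trig \<tau>" and \<tau>: "\<tau> \<le> 0" by blast
  show "(\<lambda>u. 1 / lam u * a u) \<in> L2_closed_span torus_leb {trig \<tau> | \<tau>. \<tau> \<le> 0}"
  proof (rule uniform_limit_in_closed_span[OF torus.finite_measure_axioms trig_le0_L2])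
    have "trig \<tau> \<in> borel_measurable torus_leb"
      by (intro borel_measurable_torus_leb borel_measurable_trig)
    then show "(\<lambda>u. 1 / lam u * a u) \<in> borel_measurable torus_leb"
      unfolding a by measurable
    fix e :: real assume e: "e > 0"
    have "uniform_limit torus (\<lambda>n u. \<Sum>k<n. \<nu> k * trig (- int k) u)
        (\<lambda>u. \<Sum>k. \<nu> k * trig (- int k) u) sequentially"
      by (rule Weierstrass_m_test[OF _ \<nu>(1)]) (simp add: norm_mult)
    then have "eventually (\<lambda>n. \<forall>u\<in>torus. dist (\<Sum>k<n. \<nu> k * trig (- int k) u)
        (\<Sum>k. \<nu> k * trig (- int k) u) < e) sequentially"
      using e unfolding uniform_limit_iff by blast
    then obtain n where n: "\<And>u. u \<in> torus \<Longrightarrow> dist (\<Sum>k<n. \<nu> k * trig (- int k) u)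
        (\<Sum>k. \<nu> k * trig (- int k) u) < e"
      unfolding eventually_sequentially by blast
    define h where "h u = (\<Sum>k<n. \<nu> k * trig (\<tau> - int k) u)" for u
    have "norm (1 / lam u * a u - h u) \<le> e" if "u \<in> torus" for u
    proof -
      have "h u = (\<Sum>k<n. \<nu> k * trig (- int k) u) * a u"
        by (simp add: h_def a sum_distrib_right mult.assoc trig_mult)
      moreover have "(\<Sum>k. \<nu> k * trig (- int k) u) = 1 / lam u"
        using \<nu>(2)[OF that] by (simp add: sums_iff)
      ultimately have "norm (1 / lam u * a u - h u) =
          norm (((\<Sum>k. \<nu> k * trig (- int k) u) - (\<Sum>k<n. \<nu> k * trig (- int k) u)) * a u)"
        by (simp only: left_diff_distrib)
      also have "\<dots> \<le> e"
        using n[OF that] by (simp add: norm_mult a dist_norm norm_minus_commute)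
      finally show ?thesis .
    qed
    moreover have "h \<in> L2_closed_span torus_leb {trig \<tau> | \<tau>. \<tau> \<le> 0}"
    proof -
      have "h \<in> complex_lin_span {trig \<tau> | \<tau>. \<tau> \<le> 0}"
        unfolding h_def using \<tau>
        by (intro complex_lin_span_sum complex_lin_span_cmult complex_lin_span_base) auto
      then show ?thesis using complex_lin_span_subset_closed_span[OF trig_le0_L2] by blast
    qed
    ultimately show "\<exists>h\<in>L2_closed_span torus_leb {trig \<tau> | \<tau>. \<tau> \<le> 0}.
        \<forall>u\<in>space torus_leb. norm (1 / lam u * a u - h u) \<le> e"
      by (intro bexI[where x = h]) auto
  qed
qed

section \<open>Completeness of the space of square-integrable functions\<close>

lemma Cauchy_rapid_subsequence:
  fixes d :: "nat \<Rightarrow> nat \<Rightarrow> ennreal"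
  assumes Cauchy: "\<And>e. e > 0 \<Longrightarrow> \<exists>N. \<forall>m\<ge>N. \<forall>n\<ge>N. d m n < e"
    and pos: "\<And>k. \<epsilon> k > 0"
  shows "\<exists>r. strict_mono r \<and> (\<forall>k. d (r (Suc k)) (r k) < \<epsilon> k)"
proof -
  have "\<forall>k. \<exists>N. \<forall>m\<ge>N. \<forall>n\<ge>N. d m n < \<epsilon> k"
    using Cauchy pos by blast
  then obtain N where N: "\<And>k m n. m \<ge> N k \<Longrightarrow> n \<ge> N k \<Longrightarrow> d m n < \<epsilon> k"
    by metis
  define r where "r = rec_nat (N 0) (\<lambda>k p. max (Suc p) (N (Suc k)))"
  have r_Suc: "r (Suc k) = max (Suc (r k)) (N (Suc k))" for k
    by (simp add: r_def)
  have mono: "r k < r (Suc k)" for k by (simp add: r_Suc)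
  have "r k \<ge> N k" for k by (cases k) (simp_all add: r_Suc, simp add: r_def)
  then have "d (r (Suc k)) (r k) < \<epsilon> k" for k
    using mono[of k] by (intro N) (auto intro: order.trans less_imp_le)
  then show ?thesis using mono by (auto simp: strict_mono_Suc_iff)
qed

text \<open>
  The integral of \<open>\<Sum>k. 2 ^ k * (norm (Y (Suc k) x - Y k x))\<^sup>2\<close> is finite, so this series converges for
  almost every \<open>x\<close>. From \<open>a \<le> 2 ^ k * a\<^sup>2 + (1/2) ^ k\<close> the increments themselves are then
  absolutely summable.
\<close>

lemma rapid_AE_convergent:
  fixes Y :: "nat \<Rightarrow> 'a \<Rightarrow> complex"
  assumes [measurable]: "\<And>k. Y k \<in> borel_measurable M"
    and rapid: "\<And>k. L2_normsq M (\<lambda>x. Y (Suc k) x - Y k x) \<le> ennreal ((1/4) ^ k)"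
  shows "AE x in M. convergent (\<lambda>k. Y k x)"
proof -
  define D where "D k x = 2 ^ k * (norm (Y (Suc k) x - Y k x))\<^sup>2" for k x
  have [measurable]: "D k \<in> borel_measurable M" for k
    unfolding D_def by measurable
  have D0: "0 \<le> D k x" for k x by (simp add: D_def)
  have "(\<integral>\<^sup>+x. (\<Sum>k. ennreal (D k x)) \<partial>M) = (\<Sum>k. \<integral>\<^sup>+x. ennreal (D k x) \<partial>M)"
    by (rule nn_integral_suminf) measurable
  also have "\<dots> \<le> (\<Sum>k. ennreal ((1/2) ^ k))"
  proof (intro suminf_le)
    fix k
    have "(\<integral>\<^sup>+x. ennreal (D k x) \<partial>M) = ennreal (2 ^ k) * L2_normsq M (\<lambda>x. Y (Suc k) x - Y k x)"
      unfolding L2_normsq_def D_def by (subst nn_integral_cmult[symmetric]) (auto simp: ennreal_mult)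
    also have "\<dots> \<le> ennreal (2 ^ k) * ennreal ((1/4) ^ k)"
      by (intro mult_left_mono rapid) auto
    also have "\<dots> = ennreal (2 ^ k * (1/4) ^ k)"
      by (simp add: ennreal_mult)
    also have "(2::real) ^ k * (1/4) ^ k = (1/2) ^ k"
      by (subst power_mult_distrib[symmetric]) simp
    finally show "(\<integral>\<^sup>+x. ennreal (D k x) \<partial>M) \<le> ennreal ((1/2) ^ k)" .
  qed auto
  also have "\<dots> = ennreal (\<Sum>k. (1/2) ^ k)"
    by (rule suminf_ennreal2) (auto intro: summable_geometric)
  finally have "(\<integral>\<^sup>+x. (\<Sum>k. ennreal (D k x)) \<partial>M) \<noteq> \<infinity>"
    by (auto simp: top_unique)
  then have "AE x in M. (\<Sum>k. ennreal (D k x)) \<noteq> \<infinity>"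
    by (intro nn_integral_noteq_infinite) measurable
  then show ?thesis
  proof eventually_elim
    fix x assume "(\<Sum>k. ennreal (D k x)) \<noteq> \<infinity>"
    then have "summable (\<lambda>k. D k x)"
      by (intro summable_suminf_not_top D0) simp
    then have sum: "summable (\<lambda>k. D k x + (1/2) ^ k)"
      by (intro summable_add summable_geometric) auto
    have "norm (Y (Suc k) x - Y k x) \<le> D k x + (1/2) ^ k" for k
    proof -
      define a where "a = norm (Y (Suc k) x - Y k x)"
      define q :: real where "q = 2 ^ k"
      have "q > 0" by (simp add: q_def)
      \<comment> \<open>Expanding the square gives \<open>q * a \<le> q\<^sup>2 * a\<^sup>2 + 1\<close>.\<close>
      have "0 \<le> (q * a - 1)\<^sup>2 + q * a" using \<open>q > 0\<close> by (simp add: a_def)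
      then have "q * a \<le> q * (q * a\<^sup>2 + 1 / q)"
        using \<open>q > 0\<close> by (simp add: power2_eq_square algebra_simps)
      then have "a \<le> q * a\<^sup>2 + 1 / q"
        using \<open>q > 0\<close> by simp
      then show ?thesis by (simp add: a_def q_def D_def power_divide)
    qed
    then have "summable (\<lambda>k. Y (Suc k) x - Y k x)"
      by (intro summable_comparison_test'[OF sum]) auto
    then have "convergent (\<lambda>n. \<Sum>k<n. Y (Suc k) x - Y k x)"
      by (simp add: summable_iff_convergent)
    then have "convergent (\<lambda>n. (\<Sum>k<n. Y (Suc k) x - Y k x) + Y 0 x)"
      by (intro convergent_add convergent_const)
    then show "convergent (\<lambda>k. Y k x)"
      by (simp add: sum_lessThan_telescope[of "\<lambda>k. Y k x"])
  qed
qed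

text \<open>
  Riesz-Fischer: a rapidly convergent subsequence has an almost everywhere limit \<open>Z\<close>, and Fatou's lemma
  bounds the distance from \<open>Y n\<close> to \<open>Z\<close>.
\<close>

lemma L2_complete:
  fixes Y :: "nat \<Rightarrow> 'a \<Rightarrow> complex"
  assumes Y: "\<And>n. Y n \<in> L2 M"
    and Cauchy: "\<And>e. e > 0 \<Longrightarrow> \<exists>N. \<forall>m\<ge>N. \<forall>n\<ge>N. L2_normsq M (\<lambda>x. Y m x - Y n x) < e"
  shows "\<exists>Z\<in>L2 M. (\<lambda>n. L2_normsq M (\<lambda>x. Y n x - Z x)) \<longlonglongrightarrow> 0"
proof -
  have [measurable]: "Y n \<in> borel_measurable M" for n using Y by (rule L2_measurable)
  obtain r where r: "strict_mono r"
      "\<And>k. L2_normsq M (\<lambda>x. Y (r (Suc k)) x - Y (r k) x) < ennreal ((1/4) ^ k)"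
    using Cauchy_rapid_subsequence[of "\<lambda>m n. L2_normsq M (\<lambda>x. Y m x - Y n x)" "\<lambda>k. ennreal ((1/4) ^ k)"]
      Cauchy by auto
  define Z where "Z x = lim (\<lambda>k. Y (r k) x)" for x
  have [measurable]: "Z \<in> borel_measurable M"
    unfolding Z_def by measurable
  have "AE x in M. convergent (\<lambda>k. Y (r k) x)"
    by (rule rapid_AE_convergent) (auto intro: less_imp_le r(2))
  then have conv: "AE x in M. (\<lambda>k. Y (r k) x) \<longlonglongrightarrow> Z x"
    by eventually_elim (simp add: Z_def convergent_LIMSEQ_iff)
  have Fatou: "L2_normsq M (\<lambda>x. Y n x - Z x) \<le> liminf (\<lambda>k. L2_normsq M (\<lambda>x. Y n x - Y (r k) x))" for n
  proof -
    have "L2_normsq M (\<lambda>x. Y n x - Z x) =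
        (\<integral>\<^sup>+x. liminf (\<lambda>k. ennreal ((norm (Y n x - Y (r k) x))\<^sup>2)) \<partial>M)"
      unfolding L2_normsq_def
    proof (rule nn_integral_cong_AE, use conv in eventually_elim)
      fix x assume "(\<lambda>k. Y (r k) x) \<longlonglongrightarrow> Z x"
      then have "(\<lambda>k. ennreal ((norm (Y n x - Y (r k) x))\<^sup>2)) \<longlonglongrightarrow> ennreal ((norm (Y n x - Z x))\<^sup>2)"
        by (intro tendsto_ennrealI tendsto_intros)
      then show "ennreal ((norm (Y n x - Z x))\<^sup>2) = liminf (\<lambda>k. ennreal ((norm (Y n x - Y (r k) x))\<^sup>2))"
        by (intro lim_imp_Liminf[symmetric]) simp_all
    qed
    also have "\<dots> \<le> liminf (\<lambda>k. L2_normsq M (\<lambda>x. Y n x - Y (r k) x))"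
      unfolding L2_normsq_def by (rule nn_integral_liminf) measurable
    finally show ?thesis .
  qed
  have small: "\<exists>N. \<forall>n\<ge>N. L2_normsq M (\<lambda>x. Y n x - Z x) \<le> e" if e: "e > 0" for e
  proof -
    obtain N where N: "\<And>m n. m \<ge> N \<Longrightarrow> n \<ge> N \<Longrightarrow> L2_normsq M (\<lambda>x. Y m x - Y n x) < e"
      using Cauchy[OF e] by blast
    have "L2_normsq M (\<lambda>x. Y n x - Z x) \<le> e" if n: "n \<ge> N" for n
    proof -
      have "eventually (\<lambda>k. L2_normsq M (\<lambda>x. Y n x - Y (r k) x) \<le> e) sequentially"
        using eventually_ge_at_top[of N]
      proof eventually_elim
        fix k assume "k \<ge> N"
        then have "r k \<ge> N" using seq_suble[OF r(1), of k] by simp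
        then show "L2_normsq M (\<lambda>x. Y n x - Y (r k) x) \<le> e"
          using N n by (intro less_imp_le) auto
      qed
      then have "liminf (\<lambda>k. L2_normsq M (\<lambda>x. Y n x - Y (r k) x)) \<le> liminf (\<lambda>k::nat. e)"
        by (rule Liminf_mono)
      with Fatou[of n] show ?thesis by (simp add: Liminf_const)
    qed
    then show ?thesis by blast
  qed
  have lim: "(\<lambda>n. L2_normsq M (\<lambda>x. Y n x - Z x)) \<longlonglongrightarrow> 0"
  proof (rule order_tendstoI)
    fix e :: ennreal assume "0 < e"
    then obtain e' where "0 < e'" "e' < e" using dense by blast
    with small[of e'] show "eventually (\<lambda>n. L2_normsq M (\<lambda>x. Y n x - Z x) < e) sequentially"
      unfolding eventually_sequentially by (meson le_less_trans)
  qed simp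
  obtain N where N: "L2_normsq M (\<lambda>x. Y N x - Z x) \<le> 1"
    using small[of 1] by auto
  have "(\<lambda>x. Y N x - Z x) \<in> L2 M"
    using N by (auto simp: L2_def intro: le_less_trans)
  from L2_diff[OF Y[of N] this] have "Z \<in> L2 M" by simp
  with lim show ?thesis by blast
qed

section \<open>Existence of stochastic integrals\<close>

locale random_measure =
  fixes P :: "'w measure" and \<mu> :: "real measure" and W :: "real set \<Rightarrow> 'w \<Rightarrow> complex"
  assumes finite: "finite_measure \<mu>"
    and uncorrelated: "uncorrelated_random_measure P \<mu> W"
begin

lemma W_L2: "A \<in> sets \<mu> \<Longrightarrow> W A \<in> L2 P"
  and W_mean: "A \<in> sets \<mu> \<Longrightarrow> (LINT w|P. W A w) = 0"
  and W_normsq: "A \<in> sets \<mu> \<Longrightarrow> L2_normsq P (W A) = emeasure \<mu> A"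
  using uncorrelated unfolding uncorrelated_random_measure_def by auto

lemma W_inner_disjoint:
  assumes "A \<in> sets \<mu>" "A' \<in> sets \<mu>" "A \<inter> A' = {}"
  shows "(LINT w|P. W A w * cnj (W A' w)) = 0"
proof -
  have "cov P (W A) (W A') = 0"
    using assms uncorrelated unfolding uncorrelated_random_measure_def by blast
  then show ?thesis using assms by (simp add: cov_def W_mean)
qed

lemma W_empty: "AE w in P. W {} w = 0"
proof -
  have "W {} \<in> borel_measurable P" by (intro L2_measurable W_L2) simp
  then have m: "(\<lambda>w. ennreal ((norm (W {} w))\<^sup>2)) \<in> borel_measurable P" by measurable
  have "L2_normsq P (W {}) = 0" using W_normsq[of "{}"] by simp
  then show ?thesis
    unfolding L2_normsq_def nn_integral_0_iff_AE[OF m] by simp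
qed

text \<open>
  Finite additivity is countable additivity for the sequence \<open>A, A', {}, {}, \<dots>\<close>: the partial sums are
  almost surely constant once they contain both sets, so their mean square error, which tends to zero, is
  zero.
\<close>

lemma W_Un:
  assumes A: "A \<in> sets \<mu>" and A': "A' \<in> sets \<mu>" and disj: "A \<inter> A' = {}"
  shows "AE w in P. W (A \<union> A') w = W A w + W A' w"
proof -
  have [measurable]: "W A \<in> borel_measurable P" "W A' \<in> borel_measurable P"
      "W (A \<union> A') \<in> borel_measurable P"
    using A A' by (auto intro!: L2_measurable W_L2)
  let ?B = "binaryset A A'"
  have "range ?B \<subseteq> sets \<mu>" "disjoint_family ?B"
    using A A' disj by (auto simp: binaryset_def disjoint_family_on_def)
  then have lim: "(\<lambda>n. L2_normsq P (\<lambda>w. W (\<Union>i. ?B i) w - (\<Sum>i<n. W (?B i) w))) \<longlonglongrightarrow> 0"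
    using uncorrelated unfolding uncorrelated_random_measure_def by blast
  have "L2_normsq P (\<lambda>w. W (\<Union>i. ?B i) w - (\<Sum>i<n+2. W (?B i) w)) =
      L2_normsq P (\<lambda>w. W (A \<union> A') w - (W A w + W A' w))" for n
  proof (rule L2_normsq_cong_AE, use W_empty in eventually_elim)
    fix w assume W0: "W {} w = 0"
    have "(\<Sum>i<n+2. W (?B i) w) = W A w + W A' w"
      by (induction n) (simp_all add: binaryset_def W0 numeral_2_eq_2)
    then show "W (\<Union>i. ?B i) w - (\<Sum>i<n+2. W (?B i) w) = W (A \<union> A') w - (W A w + W A' w)"
      by (simp only: UN_binaryset_eq)
  qed
  then have "L2_normsq P (\<lambda>w. W (A \<union> A') w - (W A w + W A' w)) = 0"
    using LIMSEQ_ignore_initial_segment[OF lim, of 2] by (simp add: LIMSEQ_const_iff)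
  then have "(\<integral>\<^sup>+w. ennreal ((norm (W (A \<union> A') w - (W A w + W A' w)))\<^sup>2) \<partial>P) = 0"
    by (simp add: L2_normsq_def)
  then show ?thesis
    by (subst (asm) nn_integral_0_iff_AE) auto
qed

text \<open>
  By additivity both values split along \<open>A \<inter> A'\<close>, and only the square of \<open>W (A \<inter> A')\<close> survives.
\<close>

lemma W_inner:
  assumes A: "A \<in> sets \<mu>" and A': "A' \<in> sets \<mu>"
  shows "(LINT w|P. W A w * cnj (W A' w)) = complex_of_real (measure \<mu> (A \<inter> A'))"
proof -
  let ?C = "A \<inter> A'"
  have [measurable]: "?C \<in> sets \<mu>" "A - A' \<in> sets \<mu>" "A' - A \<in> sets \<mu>"
    using A A' by auto
  note L2 = W_L2[OF A] W_L2[OF A'] W_L2[OF \<open>?C \<in> sets \<mu>\<close>] W_L2[OF \<open>A - A' \<in> sets \<mu>\<close>]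
    W_L2[OF \<open>A' - A \<in> sets \<mu>\<close>]
  note [measurable] = L2[THEN L2_measurable]
  note int [simp] = L2_integrable_mult[OF L2(3) L2(2)] L2_integrable_mult[OF L2(4) L2(2)]
    L2_integrable_mult[OF L2(3) L2(3)] L2_integrable_mult[OF L2(3) L2(5)]
  have "AE w in P. W (?C \<union> (A - A')) w = W ?C w + W (A - A') w"
    by (rule W_Un) auto
  then have 1: "AE w in P. W A w = W ?C w + W (A - A') w"
    by (simp add: Int_Diff_Un)
  have "AE w in P. W (?C \<union> (A' - A)) w = W ?C w + W (A' - A) w"
    by (rule W_Un) auto
  then have 2: "AE w in P. W A' w = W ?C w + W (A' - A) w"
    by (simp add: Int_commute[of A A'] Int_Diff_Un)
  have "(LINT w|P. W A w * cnj (W A' w)) =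
      (LINT w|P. W ?C w * cnj (W A' w) + W (A - A') w * cnj (W A' w))"
    using 1 by (intro integral_cong_AE) (auto simp: distrib_right)
  also have "\<dots> = (LINT w|P. W ?C w * cnj (W A' w))"
    using A' by (simp add: W_inner_disjoint Diff_Int_distrib2)
  also have "\<dots> = (LINT w|P. W ?C w * cnj (W ?C w) + W ?C w * cnj (W (A' - A) w))"
    using 2 by (intro integral_cong_AE) (auto simp: distrib_left)
  also have "\<dots> = (LINT w|P. W ?C w * cnj (W ?C w))"
    using W_inner_disjoint[of ?C "A' - A"] by auto
  finally have eq: "(LINT w|P. W A w * cnj (W A' w)) = (LINT w|P. W ?C w * cnj (W ?C w))" .
  have "ennreal (Re (LINT w|P. W ?C w * cnj (W ?C w))) = ennreal (measure \<mu> ?C)"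
    using W_normsq[of ?C] finite
    by (simp add: L2_normsq_eq_inner[OF L2(3)] finite_measure.emeasure_eq_measure)
  then have "Re (LINT w|P. W ?C w * cnj (W ?C w)) = measure \<mu> ?C"
    by (subst (asm) ennreal_inj) (auto intro: L2_inner_self_nonneg)
  moreover have "Im (LINT w|P. W ?C w * cnj (W ?C w)) = 0"
    using L2_inner_commute[of P "W ?C" "W ?C"] by (simp add: complex_eq_iff)
  ultimately show ?thesis by (simp add: eq complex_eq_iff)
qed

abbreviation I :: "(real \<Rightarrow> complex) \<Rightarrow> 'w \<Rightarrow> complex" where
  "I \<equiv> simple_stoch_integral \<mu> W"

lemma I_L2: "simple_function \<mu> s \<Longrightarrow> I s \<in> L2 P"
  unfolding simple_stoch_integral_def by (intro L2_sum L2_cmult W_L2 simple_functionD)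

lemma I_inner:
  assumes s: "simple_function \<mu> s" and r: "simple_function \<mu> r"
  shows "(LINT w|P. I s w * cnj (I r w)) = (LINT u|\<mu>. s u * cnj (r u))"
proof -
  interpret finite_measure \<mu> by (rule finite)
  let ?S = "\<lambda>y. s -` {y} \<inter> space \<mu>" and ?R = "\<lambda>z. r -` {z} \<inter> space \<mu>"
  have sets: "?S y \<in> sets \<mu>" "?R z \<in> sets \<mu>" for y z
    using s r by (auto intro: simple_functionD)
  have "(LINT w|P. I s w * cnj (I r w)) =
      (LINT w|P. (\<Sum>y\<in>s ` space \<mu>. \<Sum>z\<in>r ` space \<mu>. (y * cnj z) * (W (?S y) w * cnj (W (?R z) w))))"
    by (simp add: simple_stoch_integral_def sum_product mult_ac)
  also have "\<dots> = (\<Sum>y\<in>s ` space \<mu>. \<Sum>z\<in>r ` space \<mu>. (y * cnj z) * (LINT w|P. W (?S y) w * cnj (W (?R z) w)))"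
    using sets by (simp add: L2_integrable_mult W_L2)
  also have "\<dots> = (\<Sum>y\<in>s ` space \<mu>. \<Sum>z\<in>r ` space \<mu>. (y * cnj z) * complex_of_real (measure \<mu> (?S y \<inter> ?R z)))"
    using sets by (simp add: W_inner)
  also have "\<dots> = (LINT u|\<mu>. (\<Sum>y\<in>s ` space \<mu>. \<Sum>z\<in>r ` space \<mu>. (y * cnj z) * indicator (?S y \<inter> ?R z) u))"
  proof -
    have ind: "has_bochner_integral \<mu> (\<lambda>u. (y * cnj z) * indicator (?S y \<inter> ?R z) u)
        ((y * cnj z) * complex_of_real (measure \<mu> (?S y \<inter> ?R z)))" for y z
    proof -
      have "has_bochner_integral \<mu> (\<lambda>u. indicator (?S y \<inter> ?R z) u *\<^sub>R (y * cnj z))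
          (measure \<mu> (?S y \<inter> ?R z) *\<^sub>R (y * cnj z))"
        using sets by (intro has_bochner_integral_indicator) (auto simp: emeasure_eq_measure)
      moreover have "indicator (?S y \<inter> ?R z) u *\<^sub>R (y * cnj z) = (y * cnj z) * indicator (?S y \<inter> ?R z) u" for u
        by (simp add: indicator_def)
      ultimately show ?thesis by (simp only: scaleR_conv_of_real mult.commute[of _ "y * cnj z"])
    qed
    show ?thesis
      by (rule has_bochner_integral_integral_eq[symmetric], intro has_bochner_integral_sum ind)
  qed
  also have "\<dots> = (LINT u|\<mu>. s u * cnj (r u))"
  proof (rule Bochner_Integration.integral_cong[OF refl])
    fix u assume u: "u \<in> space \<mu>"
    have "(\<Sum>y\<in>s ` space \<mu>. \<Sum>z\<in>r ` space \<mu>. (y * cnj z) * indicator (?S y \<inter> ?R z) u) =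
        (\<Sum>y\<in>s ` space \<mu>. \<Sum>z\<in>r ` space \<mu>. if z = r u then (if y = s u then y * cnj z else 0) else 0)"
      using u by (intro sum.cong refl) (auto simp: indicator_def)
    also have "\<dots> = s u * cnj (r u)"
      using u simple_functionD(1)[OF s] simple_functionD(1)[OF r] by (simp add: sum.delta)
    finally show "(\<Sum>y\<in>s ` space \<mu>. \<Sum>z\<in>r ` space \<mu>. (y * cnj z) * indicator (?S y \<inter> ?R z) u) = s u * cnj (r u)" .
  qed
  finally show ?thesis .
qed

lemma I_isometry:
  assumes "simple_function \<mu> s" "simple_function \<mu> r" "s \<in> L2 \<mu>" "r \<in> L2 \<mu>"
  shows "L2_normsq P (\<lambda>w. I s w - I r w) = L2_normsq \<mu> (\<lambda>u. s u - r u)"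
  using assms by (simp add: L2_normsq_diff_eq_inner I_L2 I_inner)

text \<open>
  Simple functions approximating \<open>g\<close> form a Cauchy sequence. By the isometry so do their integrals, and
  \<open>L2 P\<close> is complete.
\<close>

lemma has_stoch_integral_exists:
  assumes g: "g \<in> L2 \<mu>"
  shows "\<exists>Y. has_stoch_integral P \<mu> W g Y"
proof -
  obtain s where s: "\<And>n::nat. simple_function \<mu> (s n)" "\<And>n. s n \<in> L2 \<mu>"
      "(\<lambda>n. L2_normsq \<mu> (\<lambda>u. s n u - g u)) \<longlonglongrightarrow> 0"
    using L2_simple_approx[OF g] by blast
  have "\<exists>Z\<in>L2 P. (\<lambda>n. L2_normsq P (\<lambda>w. I (s n) w - Z w)) \<longlonglongrightarrow> 0"
  proof (rule L2_complete)
    fix e :: ennreal assume e: "e > 0"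
    then have "e / 4 > 0" by (simp add: ennreal_zero_less_divide)
    with s(3) have "eventually (\<lambda>n. L2_normsq \<mu> (\<lambda>u. s n u - g u) < e / 4) sequentially"
      by (rule order_tendstoD)
    then obtain N where N: "\<And>n. n \<ge> N \<Longrightarrow> L2_normsq \<mu> (\<lambda>u. s n u - g u) < e / 4"
      by (auto simp: eventually_sequentially)
    have "L2_normsq P (\<lambda>w. I (s m) w - I (s n) w) < e" if "m \<ge> N" "n \<ge> N" for m n
    proof -
      have "L2_normsq P (\<lambda>w. I (s m) w - I (s n) w) = L2_normsq \<mu> (\<lambda>u. s m u - s n u)"
        by (intro I_isometry s)
      also have "\<dots> \<le> 2 * L2_normsq \<mu> (\<lambda>u. s m u - g u) + 2 * L2_normsq \<mu> (\<lambda>u. g u - s n u)"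
        by (intro L2_normsq_triangle L2_measurable g s(2))
      also have "\<dots> < e"
        using N[OF that(1)] N[OF that(2)]
        by (intro ennreal_quarter_bound e) (simp_all add: L2_normsq_minus_commute[of \<mu> g])
      finally show ?thesis .
    qed
    then show "\<exists>N. \<forall>m\<ge>N. \<forall>n\<ge>N. L2_normsq P (\<lambda>w. I (s m) w - I (s n) w) < e" by blast
  qed (rule I_L2[OF s(1)])
  then show ?thesis
    unfolding has_stoch_integral_def using g s by blast
qed

end

section \<open>Passing to Lebesgue measure through the outer factor\<close>

locale spectral_factor =
  fixes f :: "real \<Rightarrow> real" and \<gamma> :: "real \<Rightarrow> complex" and \<mu> :: "real measure"
  assumes f_measurable [measurable]: "f \<in> borel_measurable torus_leb"
    and \<mu>_def: "\<mu> = density torus_leb (\<lambda>u. ennreal (f u))"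
    and f_pos: "AE u in torus_leb. 0 < f u"
    and f_eq: "AE u in torus_leb. f u = (norm (\<gamma> u))\<^sup>2"
    and outer: "outer \<gamma>"
begin

lemma sets_\<mu> [measurable_cong, simp]: "sets \<mu> = sets torus_leb"
  by (simp add: \<mu>_def)

lemma space_\<mu> [simp]: "space \<mu> = torus"
  using sets_eq_imp_space_eq[OF sets_\<mu>] by simp

lemma \<gamma>_L2: "\<gamma> \<in> L2 torus_leb"
  using outer by (simp add: outer_def)

lemma \<gamma>_measurable [measurable]: "\<gamma> \<in> borel_measurable torus_leb"
  using \<gamma>_L2 by (rule L2_measurable)

lemma \<gamma>_nonzero: "AE u in torus_leb. \<gamma> u \<noteq> 0"
  using f_pos f_eq by eventually_elim auto

lemma AE_\<mu>: "AE u in torus_leb. R u \<Longrightarrow> AE u in \<mu>. R u"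
  unfolding \<mu>_def by (subst AE_density) (auto elim: eventually_mono)

text \<open>
  Multiplication by \<open>\<gamma>\<close> is an isometry from \<open>L2 \<mu>\<close> to \<open>L2 torus_leb\<close>.
\<close>

lemma L2_normsq_\<mu>:
  assumes [measurable]: "g \<in> borel_measurable torus_leb"
  shows "L2_normsq \<mu> g = L2_normsq torus_leb (\<lambda>u. \<gamma> u * g u)"
proof -
  have "L2_normsq \<mu> g = (\<integral>\<^sup>+u. ennreal (f u) * ennreal ((norm (g u))\<^sup>2) \<partial>torus_leb)"
    unfolding L2_normsq_def \<mu>_def by (rule nn_integral_density) measurable
  also have "\<dots> = L2_normsq torus_leb (\<lambda>u. \<gamma> u * g u)"
    unfolding L2_normsq_def
    by (rule nn_integral_cong_AE, use f_eq in eventually_elim)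
       (simp add: norm_mult power_mult_distrib ennreal_mult)
  finally show ?thesis .
qed

lemma measurable_\<mu>_iff: "g \<in> borel_measurable \<mu> \<longleftrightarrow> g \<in> borel_measurable torus_leb"
  by (simp cong: measurable_cong_sets)

lemma L2_\<mu>_iff:
  assumes [measurable]: "g \<in> borel_measurable torus_leb"
  shows "g \<in> L2 \<mu> \<longleftrightarrow> (\<lambda>u. \<gamma> u * g u) \<in> L2 torus_leb"
  by (simp add: L2_def L2_normsq_\<mu> measurable_\<mu>_iff)

lemma \<gamma>_trig_L2: "{(\<lambda>u. \<gamma> u * trig \<tau> u) | \<tau>. \<tau> \<le> 0} \<subseteq> L2 torus_leb"
proof clarify
  fix \<tau>
  have [measurable]: "trig \<tau> \<in> borel_measurable torus_leb"
    by (intro borel_measurable_torus_leb borel_measurable_trig)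
  have "L2_normsq torus_leb (\<lambda>u. \<gamma> u * trig \<tau> u) = L2_normsq torus_leb \<gamma>"
    by (simp add: L2_normsq_def norm_mult)
  then show "(\<lambda>u. \<gamma> u * trig \<tau> u) \<in> L2 torus_leb"
    using \<gamma>_L2 by (simp add: L2_def)
qed

lemma trig_L2_\<mu>: "{trig \<tau> | \<tau>. \<tau> \<le> 0} \<subseteq> L2 \<mu>"
proof clarify
  fix \<tau> :: int assume "\<tau> \<le> 0"
  then have "(\<lambda>u. \<gamma> u * trig \<tau> u) \<in> L2 torus_leb"
    using \<gamma>_trig_L2 by blast
  then show "trig \<tau> \<in> L2 \<mu>"
    by (subst L2_\<mu>_iff) (auto intro: borel_measurable_torus_leb)
qed

lemma mult_\<gamma>_G_le0:
  assumes g: "g \<in> G_le0 \<mu>"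
  shows "(\<lambda>u. \<gamma> u * g u) \<in> L2_le0"
  unfolding L2_le0_def
proof (rule closed_span_mult[OF trig_L2_\<mu> trig_le0_L2 _ _ _ g[unfolded G_le0_def]])
  show "(\<lambda>u. \<gamma> u * h u) \<in> borel_measurable torus_leb" if "h \<in> borel_measurable \<mu>" for h
    using that unfolding measurable_\<mu>_iff by measurable
  show "L2_normsq torus_leb (\<lambda>u. \<gamma> u * h u) \<le> L2_normsq \<mu> h" if "h \<in> borel_measurable \<mu>" for h
    using that by (simp add: measurable_\<mu>_iff L2_normsq_\<mu>)
  fix a assume "a \<in> {trig \<tau> | \<tau>. \<tau> \<le> 0}"
  then have "(\<lambda>u. \<gamma> u * a u) \<in> {(\<lambda>u. \<gamma> u * trig \<tau> u) | \<tau>. \<tau> \<le> 0}" by auto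
  then have "(\<lambda>u. \<gamma> u * a u) \<in> L2_closed_span torus_leb {(\<lambda>u. \<gamma> u * trig \<tau> u) | \<tau>. \<tau> \<le> 0}"
    by (rule closed_span_base[OF \<gamma>_trig_L2])
  then show "(\<lambda>u. \<gamma> u * a u) \<in> L2_closed_span torus_leb {trig \<tau> | \<tau>. \<tau> \<le> 0}"
    using outer by (simp add: outer_def L2_le0_def)
qed

lemma divide_\<gamma>_L2_le0:
  assumes \<phi>: "\<phi> \<in> L2_le0"
  shows "(\<lambda>u. 1 / \<gamma> u * \<phi> u) \<in> G_le0 \<mu>"
  unfolding G_le0_def
proof (rule closed_span_mult[OF \<gamma>_trig_L2 trig_L2_\<mu>])
  show "\<phi> \<in> L2_closed_span torus_leb {(\<lambda>u. \<gamma> u * trig \<tau> u) | \<tau>. \<tau> \<le> 0}"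
    using \<phi> outer by (simp add: outer_def)
  show "(\<lambda>u. 1 / \<gamma> u * h u) \<in> borel_measurable \<mu>" if [measurable]: "h \<in> borel_measurable torus_leb" for h
    unfolding measurable_\<mu>_iff by measurable
  show "L2_normsq \<mu> (\<lambda>u. 1 / \<gamma> u * h u) \<le> L2_normsq torus_leb h"
    if [measurable]: "h \<in> borel_measurable torus_leb" for h
  proof -
    have "L2_normsq \<mu> (\<lambda>u. 1 / \<gamma> u * h u) = L2_normsq torus_leb (\<lambda>u. \<gamma> u * (1 / \<gamma> u * h u))"
      by (rule L2_normsq_\<mu>) measurable
    also have "\<dots> = L2_normsq torus_leb h"
      by (rule L2_normsq_cong_AE, use \<gamma>_nonzero in eventually_elim) simp
    finally show ?thesis by simp
  qed
  fix a assume "a \<in> {(\<lambda>u. \<gamma> u * trig \<tau> u) | \<tau>. \<tau> \<le> 0}"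
  then obtain \<tau> where a: "a = (\<lambda>u. \<gamma> u * trig \<tau> u)" and \<tau>: "\<tau> \<le> 0" by blast
  have "trig \<tau> \<in> L2_closed_span \<mu> {trig \<tau> | \<tau>. \<tau> \<le> 0}"
    by (rule closed_span_base[OF trig_L2_\<mu>]) (use \<tau> in auto)
  moreover have "AE u in \<mu>. trig \<tau> u = 1 / \<gamma> u * a u"
    by (rule AE_\<mu>, use \<gamma>_nonzero in eventually_elim) (simp add: a)
  moreover have "(\<lambda>u. 1 / \<gamma> u * a u) \<in> borel_measurable \<mu>"
  proof -
    have [measurable]: "trig \<tau> \<in> borel_measurable torus_leb"
      by (intro borel_measurable_torus_leb borel_measurable_trig)
    show ?thesis unfolding measurable_\<mu>_iff a by measurable
  qed
  ultimately show "(\<lambda>u. 1 / \<gamma> u * a u) \<in> L2_closed_span \<mu> {trig \<tau> | \<tau>. \<tau> \<le> 0}"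
    by (rule closed_span_cong_AE)
qed

text \<open>
  The isometry identifies \<open>G_le0 \<mu>\<close> with \<open>L2_le0\<close>. That the image is all of
  \<open>L2_le0\<close> is what outerness of \<open>\<gamma>\<close> means.
\<close>

lemma G_le0_iff:
  assumes [measurable]: "g \<in> borel_measurable torus_leb"
  shows "g \<in> G_le0 \<mu> \<longleftrightarrow> (\<lambda>u. \<gamma> u * g u) \<in> L2_le0"
proof
  assume "(\<lambda>u. \<gamma> u * g u) \<in> L2_le0"
  from divide_\<gamma>_L2_le0[OF this] show "g \<in> G_le0 \<mu>"
    unfolding G_le0_def
  proof (rule closed_span_cong_AE)
    show "AE u in \<mu>. 1 / \<gamma> u * (\<gamma> u * g u) = g u"
      by (rule AE_\<mu>, use \<gamma>_nonzero in eventually_elim) simp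
  qed (simp add: measurable_\<mu>_iff)
qed (rule mult_\<gamma>_G_le0)

lemma G_le0_measurable: "g \<in> G_le0 \<mu> \<Longrightarrow> g \<in> borel_measurable torus_leb"
  unfolding G_le0_def by (drule closed_span_L2, drule L2_measurable) (simp add: measurable_\<mu>_iff)

end

section \<open>The optimal adaptive approximation\<close>

text \<open>
  Completing the square in \<open>z\<close>; the last summand is the cost of the unrestricted optimum
  \<open>1 / (L + 1)\<close>.
\<close>

lemma cost_identity:
  fixes z :: complex and L :: real
  assumes "L \<ge> 0"
  shows "(norm (z - 1))\<^sup>2 + (norm z)\<^sup>2 * L =
    (norm (z - complex_of_real (1 / (L + 1))))\<^sup>2 * (L + 1) + L / (L + 1)"
proof -
  define k where "k = 1 / (L + 1)"
  have k: "k * (L + 1) = 1" and "L / (L + 1) = 1 - k"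
    using assms by (simp_all add: k_def field_simps)
  moreover have "(Re z - 1)\<^sup>2 + (Im z)\<^sup>2 + ((Re z)\<^sup>2 + (Im z)\<^sup>2) * L =
      ((Re z - k)\<^sup>2 + (Im z)\<^sup>2) * (L + 1) + (1 - k)"
    using k by algebra
  ultimately show ?thesis by (simp add: cmod_power2 flip: k_def)
qed

locale adaptive_approximation = spectral_factor +
  fixes l :: "complex \<Rightarrow> complex" and lam Q :: "real \<Rightarrow> complex"
  assumes lam_energy: "\<And>u. u \<in> torus \<Longrightarrow> (norm (l (cis u)))\<^sup>2 + 1 = (norm (lam u))\<^sup>2"
    and lam_causal: "causal_inverse lam"
    and lam_preserves: "preserves_G_le0 \<mu> lam"
    and Q: "is_L2_projection torus_leb L2_gt0 (\<lambda>u. \<gamma> u / cnj (lam u)) Q"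
begin

lemma norm_lam_ge1:
  assumes "u \<in> torus"
  shows "norm (lam u) \<ge> 1"
proof (rule power2_le_imp_le)
  show "1\<^sup>2 \<le> (norm (lam u))\<^sup>2" by (simp flip: lam_energy[OF assms])
qed simp

lemma lam_measurable [measurable]: "lam \<in> borel_measurable torus_leb"
  using lam_causal by (rule causal_inverse_measurable)

text \<open>
  The isometry and multiplication by \<open>lam\<close> send the unrestricted optimum \<open>1 / (norm (lam u))\<^sup>2\<close> to
  \<open>target\<close>; any \<open>g\<close> becomes \<open>\<gamma> * lam * g\<close>.
\<close>

definition target :: "real \<Rightarrow> complex" where "target u = \<gamma> u / cnj (lam u)"

definition causal_part :: "real \<Rightarrow> complex" where "causal_part u = target u - Q u"

lemma target_L2: "target \<in> L2 torus_leb"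
  using Q by (simp add: is_L2_projection_def target_def[abs_def])

lemma Q_gt0: "Q \<in> L2_gt0"
  using Q by (simp add: is_L2_projection_def)

lemma Q_L2: "Q \<in> L2 torus_leb"
  using Q_gt0 unfolding L2_gt0_def by (rule closed_span_L2)

lemma causal_part_L2: "causal_part \<in> L2 torus_leb"
  unfolding causal_part_def[abs_def] by (intro L2_diff target_L2 Q_L2)

lemma Q_measurable [measurable]: "Q \<in> borel_measurable torus_leb"
  and target_measurable [measurable]: "target \<in> borel_measurable torus_leb"
  by (intro L2_measurable Q_L2 target_L2)+

text \<open>
  Subtracting the projection onto the positive frequencies leaves only nonpositive ones.
\<close>

lemma causal_part_le0: "causal_part \<in> L2_le0"
proof (rule orthogonal_L2_gt0_imp_L2_le0[OF causal_part_L2])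
  fix \<tau> :: int assume "\<tau> > 0"
  then have "trig \<tau> \<in> L2_gt0"
    unfolding L2_gt0_def
    by (intro closed_span_base[OF trig_gt0_L2]) auto
  then show "(LINT u|torus_leb. causal_part u * cnj (trig \<tau> u)) = 0"
    using Q by (simp add: is_L2_projection_def causal_part_def target_def)
qed

abbreviation g_opt :: "real \<Rightarrow> complex" where
  "g_opt \<equiv> g_star \<gamma> lam Q"

lemma g_opt_measurable [measurable]: "g_opt \<in> borel_measurable torus_leb"
  unfolding g_star_def[abs_def] by measurable

text \<open>
  The formula for \<open>g_opt\<close> solves \<open>\<gamma> * lam * g = causal_part\<close>. That identity can fail where \<open>\<gamma>\<close> vanishes, since a
  quotient by zero is zero, but only on a null set.
\<close>

lemma \<gamma>_g_opt: "AE u in torus_leb. \<gamma> u * g_opt u = 1 / lam u * causal_part u"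
proof -
  have "AE u in torus_leb. u \<in> torus" by (rule AE_I2) simp
  with \<gamma>_nonzero show ?thesis
  proof eventually_elim
    fix u assume u: "u \<in> torus" and \<gamma>: "\<gamma> u \<noteq> 0"
    have "lam u \<noteq> 0" using norm_lam_ge1[OF u] by auto
    then show "\<gamma> u * g_opt u = 1 / lam u * causal_part u"
      using \<gamma> unfolding g_star_def causal_part_def target_def complex_norm_square
      by (simp add: field_simps)
  qed
qed

lemma g_opt_G_le0: "g_opt \<in> G_le0 \<mu>"
proof -
  have "(\<lambda>u. 1 / lam u * causal_part u) \<in> L2_le0"
    using lam_causal norm_lam_ge1 causal_part_le0 by (rule causal_inverse_mult_L2_le0)
  then have "(\<lambda>u. \<gamma> u * g_opt u) \<in> L2_le0"
    unfolding L2_le0_def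
  proof (rule closed_span_cong_AE)
    show "AE u in torus_leb. 1 / lam u * causal_part u = \<gamma> u * g_opt u"
      using \<gamma>_g_opt by eventually_elim simp
  qed measurable
  then show ?thesis by (simp add: G_le0_iff)
qed

lemma adaptivity_loss_eq:
  assumes [measurable]: "g \<in> borel_measurable torus_leb"
  shows "adaptivity_loss \<mu> l g = L2_normsq torus_leb (\<lambda>u. \<gamma> u * (lam u * g u) - target u)"
proof -
  have "adaptivity_loss \<mu> l g = L2_normsq \<mu> (\<lambda>u. lam u * g u - 1 / cnj (lam u))"
    unfolding adaptivity_loss_def L2_normsq_def
  proof (rule nn_integral_cong)
    fix u assume "u \<in> space \<mu>"
    then have u: "u \<in> torus" by simp
    have "lam u \<noteq> 0" using norm_lam_ge1[OF u] by auto
    then have "lam u * g u - 1 / cnj (lam u) = (g u - complex_of_real (1 / (norm (lam u))\<^sup>2)) * lam u"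
      unfolding of_real_divide complex_norm_square by (simp add: field_simps)
    then have "(norm (lam u * g u - 1 / cnj (lam u)))\<^sup>2 =
        (norm (g u - complex_of_real (1 / (norm (lam u))\<^sup>2)))\<^sup>2 * (norm (lam u))\<^sup>2"
      by (simp only: norm_mult power_mult_distrib)
    then show "ennreal ((norm (g u - complex_of_real (1 / ((norm (l (cis u)))\<^sup>2 + 1))))\<^sup>2
        * ((norm (l (cis u)))\<^sup>2 + 1)) = ennreal ((norm (lam u * g u - 1 / cnj (lam u)))\<^sup>2)"
      by (simp only: lam_energy[OF u])
  qed
  also have "\<dots> = L2_normsq torus_leb (\<lambda>u. \<gamma> u * (lam u * g u - 1 / cnj (lam u)))"
    by (rule L2_normsq_\<mu>) measurable
  also have "\<dots> = L2_normsq torus_leb (\<lambda>u. \<gamma> u * (lam u * g u) - target u)"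
    by (simp add: target_def right_diff_distrib)
  finally show ?thesis .
qed

text \<open>
  When the loss is finite, \<open>lam * g\<close> is square-integrable, so \<open>\<gamma> * lam * g\<close> lies in \<open>L2_le0\<close> because \<open>lam\<close>
  preserves \<open>G_le0 \<mu>\<close>. Its difference from \<open>causal_part\<close> is then orthogonal to \<open>Q\<close>, and
  Pythagoras applies to \<open>\<gamma> * lam * g - target = (\<gamma> * lam * g - causal_part) - Q\<close>.
\<close>

lemma adaptivity_loss_ge:
  assumes g: "g \<in> G_le0 \<mu>"
  shows "L2_normsq torus_leb Q \<le> adaptivity_loss \<mu> l g"
proof (cases "adaptivity_loss \<mu> l g = \<infinity>")
  case False
  have [measurable]: "g \<in> borel_measurable torus_leb" using g by (rule G_le0_measurable)
  define \<phi> where "\<phi> u = \<gamma> u * (lam u * g u)" for u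
  have \<phi>_meas [measurable]: "\<phi> \<in> borel_measurable torus_leb"
    unfolding \<phi>_def by measurable
  have loss: "adaptivity_loss \<mu> l g = L2_normsq torus_leb (\<lambda>u. \<phi> u - target u)"
    by (simp add: adaptivity_loss_eq \<phi>_def)
  with False have "(\<lambda>u. \<phi> u - target u) \<in> L2 torus_leb"
    by (simp add: L2_def less_top)
  from L2_add[OF this target_L2] have "\<phi> \<in> L2 torus_leb" by simp
  then have "(\<lambda>u. lam u * g u) \<in> L2 \<mu>"
    by (subst L2_\<mu>_iff) (auto simp: \<phi>_def[abs_def])
  then have "(\<lambda>u. lam u * g u) \<in> G_le0 \<mu>"
    using lam_preserves g by (simp add: preserves_G_le0_def)
  then have \<phi>: "\<phi> \<in> L2_le0"
    unfolding \<phi>_def[abs_def] by (rule mult_\<gamma>_G_le0)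
  have diff: "(\<lambda>u. 1 * \<phi> u + (-1) * causal_part u) \<in> L2_le0"
    using \<phi> causal_part_le0 unfolding L2_le0_def by (rule closed_span_add_scaled[OF trig_le0_L2])
  then have diff_L2: "(\<lambda>u. 1 * \<phi> u + (-1) * causal_part u) \<in> L2 torus_leb"
    unfolding L2_le0_def by (rule closed_span_L2)
  have "L2_normsq torus_leb (\<lambda>u. (1 * \<phi> u + (-1) * causal_part u) - Q u) =
      L2_normsq torus_leb (\<lambda>u. 1 * \<phi> u + (-1) * causal_part u) + L2_normsq torus_leb Q"
    by (rule L2_pythagoras_diff[OF diff_L2 Q_L2 L2_le0_orthogonal_L2_gt0[OF diff Q_gt0]])
  also have "(\<lambda>u. (1 * \<phi> u + (-1) * causal_part u) - Q u) = (\<lambda>u. \<phi> u - target u)"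
    by (simp add: causal_part_def)
  finally show ?thesis by (simp add: loss)
qed simp

lemma adaptivity_loss_g_opt: "adaptivity_loss \<mu> l g_opt = L2_normsq torus_leb Q"
proof -
  have "adaptivity_loss \<mu> l g_opt = L2_normsq torus_leb (\<lambda>u. \<gamma> u * (lam u * g_opt u) - target u)"
    by (rule adaptivity_loss_eq) measurable
  also have "\<dots> = L2_normsq torus_leb (\<lambda>u. - Q u)"
  proof (rule L2_normsq_cong_AE)
    have "AE u in torus_leb. u \<in> torus" by (rule AE_I2) simp
    with \<gamma>_g_opt show "AE u in torus_leb. \<gamma> u * (lam u * g_opt u) - target u = - Q u"
    proof eventually_elim
      fix u assume "u \<in> torus" and eq: "\<gamma> u * g_opt u = 1 / lam u * causal_part u"
      then have "lam u \<noteq> 0" using norm_lam_ge1 by force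
      have "\<gamma> u * (lam u * g_opt u) = lam u * (\<gamma> u * g_opt u)" by simp
      also have "\<dots> = causal_part u" using \<open>lam u \<noteq> 0\<close> by (simp add: eq)
      finally show "\<gamma> u * (lam u * g_opt u) - target u = - Q u" by (simp add: causal_part_def)
    qed
  qed
  also have "\<dots> = L2_normsq torus_leb Q"
    by (simp add: L2_normsq_def)
  finally show ?thesis .
qed

lemma ERR_A_eq: "ERR_A \<mu> l = L2_normsq torus_leb Q"
  unfolding ERR_A_def
proof (rule antisym)
  show "(INF g\<in>G_le0 \<mu>. adaptivity_loss \<mu> l g) \<le> L2_normsq torus_leb Q"
    using INF_lower[OF g_opt_G_le0, of "adaptivity_loss \<mu> l"] by (simp add: adaptivity_loss_g_opt)
qed (intro INF_greatest adaptivity_loss_ge)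

lemma approx_cost_eq:
  assumes [measurable]: "g \<in> borel_measurable torus_leb"
  shows "approx_cost \<mu> l g = adaptivity_loss \<mu> l g +
    (\<integral>\<^sup>+u. ennreal (((norm (lam u))\<^sup>2 - 1) / (norm (lam u))\<^sup>2) \<partial>\<mu>)"
proof -
  let ?loss = "\<lambda>u. (norm (g u - complex_of_real (1 / (norm (lam u))\<^sup>2)))\<^sup>2 * (norm (lam u))\<^sup>2"
  let ?base = "\<lambda>u. ((norm (lam u))\<^sup>2 - 1) / (norm (lam u))\<^sup>2"
  have "approx_cost \<mu> l g = (\<integral>\<^sup>+u. ennreal (?loss u) + ennreal (?base u) \<partial>\<mu>)"
    unfolding approx_cost_def
  proof (rule nn_integral_cong)
    fix u assume "u \<in> space \<mu>"
    then have u: "u \<in> torus" by simp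
    have L: "(norm (l (cis u)))\<^sup>2 = (norm (lam u))\<^sup>2 - 1" using lam_energy[OF u] by simp
    have "?base u \<ge> 0"
      using L zero_le_power2[of "norm (l (cis u))"] by (intro divide_nonneg_nonneg) auto
    moreover have "(norm (g u - 1))\<^sup>2 + (norm (g u))\<^sup>2 * (norm (l (cis u)))\<^sup>2 = ?loss u + ?base u"
      using cost_identity[OF zero_le_power2[of "norm (l (cis u))"], of "g u"] by (simp only: L) simp
    ultimately show "ennreal ((norm (g u - 1))\<^sup>2 + (norm (g u))\<^sup>2 * (norm (l (cis u)))\<^sup>2) =
        ennreal (?loss u) + ennreal (?base u)"
      by (simp only: ennreal_plus mult_nonneg_nonneg zero_le_power2)
  qed
  also have "\<dots> = (\<integral>\<^sup>+u. ennreal (?loss u) \<partial>\<mu>) + (\<integral>\<^sup>+u. ennreal (?base u) \<partial>\<mu>)"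
    by (rule nn_integral_add) measurable
  also have "(\<integral>\<^sup>+u. ennreal (?loss u) \<partial>\<mu>) = adaptivity_loss \<mu> l g"
    unfolding adaptivity_loss_def by (rule nn_integral_cong) (simp add: lam_energy)
  finally show ?thesis .
qed

lemma g_opt_minimizes_cost:
  assumes g: "g \<in> G_le0 \<mu>"
  shows "approx_cost \<mu> l g_opt \<le> approx_cost \<mu> l g"
  using adaptivity_loss_ge[OF g]
  by (simp add: approx_cost_eq G_le0_measurable[OF g] adaptivity_loss_g_opt add_right_mono)

lemma g_opt_trig_L2: "(\<lambda>u. g_opt u * trig t u) \<in> L2 \<mu>"
proof -
  have [measurable]: "trig t \<in> borel_measurable torus_leb"
    by (intro borel_measurable_torus_leb borel_measurable_trig)
  have "L2_normsq \<mu> (\<lambda>u. g_opt u * trig t u) = L2_normsq \<mu> g_opt"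
    by (simp add: L2_normsq_def norm_mult)
  moreover have "g_opt \<in> L2 \<mu>"
    using g_opt_G_le0 unfolding G_le0_def by (rule closed_span_L2)
  ultimately show ?thesis
    by (simp add: L2_def measurable_\<mu>_iff)
qed

end

theorem theorem3p1:
  fixes P :: "'w measure" and B :: "int \<Rightarrow> 'w \<Rightarrow> complex"
    and \<mu> :: "real measure" and W :: "real set \<Rightarrow> 'w \<Rightarrow> complex"
    and f :: "real \<Rightarrow> real" and l :: "complex \<Rightarrow> complex"
    and \<gamma> lam Q :: "real \<Rightarrow> complex"
  assumes "prob_space P"
    and "centered_wide_sense_stationary P B"
    and "is_spectral_measure P B \<mu>"
    and "uncorrelated_random_measure P \<mu> W"
    and "\<And>t. has_stoch_integral P \<mu> W (trig t) (B t)"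
    and "f \<in> borel_measurable torus_leb"
    and "\<mu> = density torus_leb (\<lambda>u. ennreal (f u))"
    and "log_integrable f"
    and "energy_function l"
    and "outer \<gamma>"
    and "AE u in torus_leb. f u = (norm (\<gamma> u))\<^sup>2"
    and "\<And>u. u \<in> torus \<Longrightarrow> (norm (l (cis u)))\<^sup>2 + 1 = (norm (lam u))\<^sup>2"
    and "causal_inverse lam"
    and "preserves_G_le0 \<mu> lam"
    and "is_L2_projection torus_leb L2_gt0 (\<lambda>u. \<gamma> u / cnj (lam u)) Q"
  shows "g_star \<gamma> lam Q \<in> G_le0 \<mu>
    \<and> (\<forall>g\<in>G_le0 \<mu>. approx_cost \<mu> l (g_star \<gamma> lam Q) \<le> approx_cost \<mu> l g)
    \<and> (\<exists>X :: int \<Rightarrow> 'w \<Rightarrow> complex.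
         \<forall>t. has_stoch_integral P \<mu> W (\<lambda>u. g_star \<gamma> lam Q u * trig t u) (X t))
    \<and> adaptivity_loss \<mu> l (g_star \<gamma> lam Q) = ERR_A \<mu> l
    \<and> ERR_A \<mu> l = L2_normsq torus_leb Q"
proof -
  have "finite_measure \<mu>"
    using assms(3) by (simp only: is_spectral_measure_def)
  then interpret random_measure P \<mu> W
    by (rule random_measure.intro[OF _ assms(4)])
  have f_pos: "AE u in torus_leb. 0 < f u"
    using assms(8) by (simp only: log_integrable_def)
  interpret adaptive_approximation f \<gamma> \<mu> l lam Q
    by unfold_locales (fact assms f_pos)+
  have "\<exists>X. \<forall>t. has_stoch_integral P \<mu> W (\<lambda>u. g_star \<gamma> lam Q u * trig t u) (X t)"
    using has_stoch_integral_exists[OF g_opt_trig_L2] by metis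
  then show ?thesis
    using g_opt_G_le0 g_opt_minimizes_cost adaptivity_loss_g_opt ERR_A_eq by simp
qed

end
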